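(* For every $n\in\mathbb{N}$: $\mathrm{Det}_{\mathfrak{D}_{n+1}}\equiv_W \mathrm{C}_{\{0,1\}^\mathbb{N}}^{[n]}$ and $\mathrm{Win}_{\mathfrak{D}_{n+1}}\equiv_W\mathrm{LPO}^{[n]}$.
   Context: Represented spaces $(X,\delta_X)$, $\delta_X:\subseteq\mathbb{N}^\mathbb{N}\to X$ partial surjection; realizers of $f:\subseteq X\rightrightarrows Y$ are $F$ with $\delta_Y(F(p))\in f(\delta_X(p))$ for $\delta_X(p)\in\mathrm{dom}(f)$. $f\leq_W g$ iff there are computable $K,H$ with $p\mapsto K(\langle p,G(H(p))\rangle)$ realizing $f$ for every realizer $G$ of $g$; $\equiv_W$ induced equivalence. $\lim:\subseteq\mathbb{N}^\mathbb{N}\to\mathbb{N}^\mathbb{N}$, $\lim(p)(n)=\lim_{i\to\infty}p(\langle n,i\rangle)$. Jump of a space: $(X,\delta_X)'=(X,\delta_X\circ\lim)$, $X^{(0)}=X$, $X^{(n+1)}=(X^{(n)})'$; for $f:X\rightrightarrows Y$, $f^{[n]}:X^{(n)}\rightrightarrows Y$ is the same map with input space replaced by its $n$-th jump. $\mathrm{LPO}:\{0,1\}^\mathbb{N}\to\{0,1\}$ outputs $1$ iff $p=0^\mathbb{N}$. $\mathrm{C}_{\{0,1\}^\mathbb{N}}$ maps a nonempty closed subset of $\{0,1\}^\mathbb{N}$ (named by an enumeration of cylinders $w\{0,1\}^\mathbb{N}$ covering its complement) to any of its elements. $\mathfrak{D}_m$ consists of sets $D\subseteq\{0,1\}^\mathbb{N}$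 for which there are open $U_0,\ldots,U_{m-1}$ with $x\in D\iff\min\{\beta\mid x\in U_\beta\}\not\equiv m\pmod 2$ ($\min\emptyset=m$), named by names of $U_0,\ldots,U_{m-1}$ (open sets named by enumerations of words whose cylinders form the set). Games: win/lose games with players 1,2, choices $\{0,1\}$, turn function $d:\{0,1\}^*\to\{1,2\}$ (lookup table), winning set for player 1, complement won by player 2; winning strategies as usual; strategy profiles are functions $\{0,1\}^*\to\{0,1\}$. $\mathrm{Det}_\Gamma$: input such a game with player-1 winning set given by a $\Gamma$-name; output any strategy profile in which one of the strategies is winning. $\mathrm{Win}_\Gamma$: same input, output which player has a winning strategy. *)

theory Defs
  imports Main "HOL-Library.Nat_Bijection"
begin

datatype recf = Zr | Sc | Proj nat | Comp recf "recf list" | Prim recf recf | Mn recf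

inductive reval :: "recf \<Rightarrow> nat list \<Rightarrow> nat \<Rightarrow> bool" where
  reval_Z: "reval Zr xs 0"
| reval_S: "reval Sc (x # xs) (Suc x)"
| reval_Proj: "i < length xs \<Longrightarrow> reval (Proj i) xs (xs ! i)"
| reval_Comp: "length ys = length gs \<Longrightarrow> (\<forall>i<length gs. reval (gs ! i) xs (ys ! i))
      \<Longrightarrow> reval f ys z \<Longrightarrow> reval (Comp f gs) xs z"
| reval_Prim0: "reval f xs y \<Longrightarrow> reval (Prim f g) (0 # xs) y"
| reval_PrimS: "reval (Prim f g) (n # xs) y \<Longrightarrow> reval g (y # n # xs) z
      \<Longrightarrow> reval (Prim f g) (Suc n # xs) z"
| reval_Mn: "reval f (n # xs) 0 \<Longrightarrow> (\<forall>m<n. \<exists>y. reval f (m # xs) y \<and> y \<noteq> 0)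
      \<Longrightarrow> reval (Mn f) xs n"

definition total_recursive :: "(nat \<Rightarrow> nat) \<Rightarrow> bool" where
  "total_recursive h \<longleftrightarrow> (\<exists>f. \<forall>x. reval f [x] (h x))"

type_synonym baire = "nat \<Rightarrow> nat"

text \<open>A partial function F on Baire space is computable if there is a total recursive h
  which, given an output index n and (the code of) a finite prefix of the input,
  either answers 0 (not yet known) or Suc v, and along every input p in the domain
  of F every output position is eventually answered and all answers are correct.
  This is the standard Type-2 (TTE) notion of computability.\<close>

definition prefix_code :: "baire \<Rightarrow> nat \<Rightarrow> nat" where
  "prefix_code p k = list_encode (map p [0..<k])"

definition computable :: "(baire \<Rightarrow> baire option) \<Rightarrow> bool" where
  "computable F \<longleftrightarrow> (\<exists>h. total_recursive h \<and>
     (\<forall>p q. F p = Some q \<longrightarrow>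
        (\<forall>n. (\<exists>k. h (prod_encode (n, prefix_code p k)) = Suc (q n)) \<and>
             (\<forall>k v. h (prod_encode (n, prefix_code p k)) = Suc v \<longrightarrow> v = q n))))"

definition pairB :: "baire \<Rightarrow> baire \<Rightarrow> baire" where
  "pairB p q = (\<lambda>k. if even k then p (k div 2) else q (k div 2))"

definition fstB :: "baire \<Rightarrow> baire" where "fstB p = (\<lambda>k. p (2 * k))"
definition sndB :: "baire \<Rightarrow> baire" where "sndB p = (\<lambda>k. p (2 * k + 1))"

definition limB :: "baire \<Rightarrow> baire option" where
  "limB p = (if (\<forall>n. \<exists>v N. \<forall>i\<ge>N. p (prod_encode (n, i)) = v)
             then Some (\<lambda>n. THE v. \<exists>N. \<forall>i\<ge>N. p (prod_encode (n, i)) = v)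
             else None)"

text \<open>A representation of a space X is a partial map delta from Baire space onto X;
  X is the range of delta.\<close>
type_synonym 'a rep = "baire \<Rightarrow> 'a option"

text \<open>A problem f :\<subseteq> X \<rightrightarrows> Y together with the representations of X and Y.
  dom(f) = the points of X with nonempty value set.\<close>
type_synonym ('a, 'b) problem = "'a rep \<times> 'b rep \<times> ('a \<Rightarrow> 'b set)"

definition realizes :: "(baire \<Rightarrow> baire option) \<Rightarrow> ('a, 'b) problem \<Rightarrow> bool" where
  "realizes F P = (case P of (dX, dY, f) \<Rightarrow>
     (\<forall>p x. dX p = Some x \<and> f x \<noteq> {} \<longrightarrow>
        (\<exists>q y. F p = Some q \<and> dY q = Some y \<and> y \<in> f x)))"

definition weihrauch_le :: "('a, 'b) problem \<Rightarrow> ('c, 'd) problem \<Rightarrow> bool" (infix "\<le>\<^sub>W" 50) where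
  "f \<le>\<^sub>W g \<longleftrightarrow> (\<exists>K H. computable K \<and> computable H \<and>
     (\<forall>G. realizes G g \<longrightarrow>
        realizes (\<lambda>p. Option.bind (H p) (\<lambda>h. Option.bind (G h) (\<lambda>r. K (pairB p r)))) f))"

definition weihrauch_eq :: "('a, 'b) problem \<Rightarrow> ('c, 'd) problem \<Rightarrow> bool" (infix "\<equiv>\<^sub>W" 50) where
  "f \<equiv>\<^sub>W g \<longleftrightarrow> f \<le>\<^sub>W g \<and> g \<le>\<^sub>W f"

definition jump_rep :: "'a rep \<Rightarrow> 'a rep" where
  "jump_rep d = (\<lambda>p. Option.bind (limB p) d)"

definition jumpn :: "nat \<Rightarrow> ('a, 'b) problem \<Rightarrow> ('a, 'b) problem" where
  "jumpn n P = (case P of (dX, dY, f) \<Rightarrow> ((jump_rep ^^ n) dX, dY, f))"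

primrec nat_of_word :: "bool list \<Rightarrow> nat" where
  "nat_of_word [] = 0"
| "nat_of_word (b # w) = 2 * nat_of_word w + (if b then 2 else 1)"

definition rep_cantor :: "(nat \<Rightarrow> bool) rep" where
  "rep_cantor p = (if \<forall>k. p k \<le> 1 then Some (\<lambda>k. p k = 1) else None)"

text \<open>Natural numbers (in particular {0,1} and players {1,2}): p |-> p(0).\<close>
definition rep_nat :: "nat rep" where
  "rep_nat p = Some (p 0)"

definition in_cyl :: "bool list \<Rightarrow> (nat \<Rightarrow> bool) \<Rightarrow> bool" where
  "in_cyl w x \<longleftrightarrow> (\<forall>i<length w. x i = w ! i)"

text \<open>Open set named by an enumeration of words: p(k) = 0 is a blank (allowing the empty set),
  p(k) = Suc c lists the word with number c.\<close>
definition open_of :: "baire \<Rightarrow> (nat \<Rightarrow> bool) set" where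
  "open_of p = {x. \<exists>k w. p k = Suc (nat_of_word w) \<and> in_cyl w x}"

definition rep_closed :: "(nat \<Rightarrow> bool) set rep" where
  "rep_closed p = Some (- open_of p)"

definition projB :: "nat \<Rightarrow> baire \<Rightarrow> baire" where
  "projB b p = (\<lambda>k. p (prod_encode (b, k)))"

definition Dm_set :: "nat \<Rightarrow> (nat \<Rightarrow> (nat \<Rightarrow> bool) set) \<Rightarrow> (nat \<Rightarrow> bool) set" where
  "Dm_set m U = {x. (if \<exists>b<m. x \<in> U b then (LEAST b. x \<in> U b) else m) mod 2 \<noteq> m mod 2}"

definition rep_Dm :: "nat \<Rightarrow> (nat \<Rightarrow> bool) set rep" where
  "rep_Dm m p = Some (Dm_set m (\<lambda>b. open_of (projB b p)))"

text \<open>A game: turn function d (values 1, 2) and winning set W of player 1.\<close>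
type_synonym game = "(bool list \<Rightarrow> nat) \<times> (nat \<Rightarrow> bool) set"

definition rep_game :: "(nat \<Rightarrow> bool) set rep \<Rightarrow> game rep" where
  "rep_game dG p = (if \<forall>k. fstB p k \<in> {1, 2}
     then (case dG (sndB p) of None \<Rightarrow> None
           | Some W \<Rightarrow> Some (\<lambda>w. fstB p (nat_of_word w), W))
     else None)"

definition rep_profile :: "(bool list \<Rightarrow> bool) rep" where
  "rep_profile p = (if \<forall>k. p k \<le> 1 then Some (\<lambda>w. p (nat_of_word w) = 1) else None)"

definition consistent :: "(bool list \<Rightarrow> nat) \<Rightarrow> nat \<Rightarrow> (bool list \<Rightarrow> bool) \<Rightarrow> (nat \<Rightarrow> bool) \<Rightarrow> bool" where
  "consistent d i s x \<longleftrightarrow> (\<forall>k. d (map x [0..<k]) = i \<longrightarrow> x k = s (map x [0..<k]))"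

definition winning :: "game \<Rightarrow> nat \<Rightarrow> (bool list \<Rightarrow> bool) \<Rightarrow> bool" where
  "winning G i s = (case G of (d, W) \<Rightarrow>
     (i = 1 \<and> (\<forall>x. consistent d 1 s x \<longrightarrow> x \<in> W)) \<or>
     (i = 2 \<and> (\<forall>x. consistent d 2 s x \<longrightarrow> x \<notin> W)))"

definition Det :: "(nat \<Rightarrow> bool) set rep \<Rightarrow> (game, bool list \<Rightarrow> bool) problem" where
  "Det dG = (rep_game dG, rep_profile, \<lambda>G. {s. winning G 1 s \<or> winning G 2 s})"

definition Win :: "(nat \<Rightarrow> bool) set rep \<Rightarrow> (game, nat) problem" where
  "Win dG = (rep_game dG, rep_nat, \<lambda>G. {i. i \<in> {1, 2} \<and> (\<exists>s. winning G i s)})"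

definition LPO :: "(nat \<Rightarrow> bool, nat) problem" where
  "LPO = (rep_cantor, rep_nat, \<lambda>x. {if (\<forall>k. \<not> x k) then 1 else 0})"

definition C_Cantor :: "((nat \<Rightarrow> bool) set, nat \<Rightarrow> bool) problem" where
  "C_Cantor = (rep_closed, rep_cantor, \<lambda>A. A)"

end

theory Submission
  imports Defs
begin

text \<open>
  Both upper bounds come from a uniform form of the determinacy proof. Let layer \<open>g\<close> belong to the
  player who wins the plays whose least open set is \<open>U\<^sub>g\<close>, and let \<open>region (g + 1)\<close> be the set of
  positions outside \<open>region g\<close> from which this player can force the play into the sets up to \<open>U\<^sub>g\<close>
  without leaving the complement of \<open>region g\<close>. Every position is decided by the least region
  containing it, and each region is enumerable relative to the preceding one, so \<open>n\<close> limits decide the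
  first \<open>n\<close> regions. Player 1 wins iff the root lies in the last one, which is an enumerable question; and
  a winning profile only has to respect, at every position, at most one forbidden move, which is
  the first successor seen to enter the relevant region (or its sibling). This is a closed condition.

  For the lower bounds, player 2 spells out a point of the closed set, and player 1 may challenge it by
  pointing at an entry of the name that removes it. As the name is an \<open>n\<close>-fold limit, the players then
  alternately unfold one limit per phase, each choosing an approximation that is late enough for
  the opponent's commitment, together with a commitment of their own. A player who never ends their phase
  loses, which costs one level of the difference hierarchy per phase.
\<close>

text \<open>With \<open>n\<close> limits the labels below \<open>n\<close> are known, but labels
  \<open>n\<close> and \<open>n + 1\<close> cannot be told apart. The upper bounds survive because
  in both cases the mover may obey the responses of layer \<open>n\<close>: its owner heads for the
  region, the opponent avoids it, and either needs a hint only once a successor has been seen to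
  enter. In the lower bounds the count of open sets is tight: the phases 0 to \<open>n\<close> use
  up \<open>n + 1\<close> levels, so the final verdict on the entry reached must not cost another
  one. It costs none because the play up to the challenge decides it, so that it can be built into
  set 0 in either polarity. A player has only one bit per round, hence numbers are conveyed by the
  round in which a phase ends. The strategies for the challenge game consult the true limits and
  need not be computable. Only the name of the game must be, and it is computed from the given name
  without taking any limit. The same game serves choice and \<open>LPO\<close>.\<close>

abbreviation pfst :: "nat \<Rightarrow> nat" where "pfst z \<equiv> fst (prod_decode z)"
abbreviation psnd :: "nat \<Rightarrow> nat" where "psnd z \<equiv> snd (prod_decode z)"

subsection \<open>Recursive functions of several arguments\<close>

definition evaluable :: "nat \<Rightarrow> (nat list \<Rightarrow> nat) \<Rightarrow> bool" where
  "evaluable k f \<longleftrightarrow> (\<exists>r. \<forall>xs. length xs = k \<longrightarrow> reval r xs (f xs))"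

lemma evaluable_cong:
  "evaluable k f \<Longrightarrow> (\<And>xs. length xs = k \<Longrightarrow> f xs = g xs) \<Longrightarrow> evaluable k g"
  unfolding evaluable_def by metis

lemma evaluable_nth: "i < k \<Longrightarrow> evaluable k (\<lambda>xs. xs ! i)"
  unfolding evaluable_def using reval_Proj by blast

lemma evaluable_zero: "evaluable k (\<lambda>xs. 0)"
  unfolding evaluable_def using reval_Z by blast

lemma evaluable_comp1:
  assumes "evaluable 1 (\<lambda>xs. f (xs ! 0))" "evaluable k g"
  shows "evaluable k (\<lambda>xs. f (g xs))"
proof -
  obtain rf rg where rf: "\<And>xs. length xs = 1 \<Longrightarrow> reval rf xs (f (xs ! 0))"
    and rg: "\<And>xs. length xs = k \<Longrightarrow> reval rg xs (g xs)"
    using assms unfolding evaluable_def by blast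
  have "reval (Comp rf [rg]) xs (f (g xs))" if "length xs = k" for xs
  proof (rule reval_Comp[where ys = "[g xs]"])
    show "reval rf [g xs] (f (g xs))" using rf[of "[g xs]"] by simp
  qed (use rg that in auto)
  then show ?thesis unfolding evaluable_def by blast
qed

lemma evaluable_comp2:
  assumes "evaluable 2 (\<lambda>xs. f (xs ! 0) (xs ! 1))" "evaluable k g" "evaluable k h"
  shows "evaluable k (\<lambda>xs. f (g xs) (h xs))"
proof -
  obtain rf rg rh where rf: "\<And>xs. length xs = 2 \<Longrightarrow> reval rf xs (f (xs ! 0) (xs ! 1))"
    and rg: "\<And>xs. length xs = k \<Longrightarrow> reval rg xs (g xs)"
    and rh: "\<And>xs. length xs = k \<Longrightarrow> reval rh xs (h xs)"
    using assms unfolding evaluable_def by blast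
  have "reval (Comp rf [rg, rh]) xs (f (g xs) (h xs))" if "length xs = k" for xs
  proof (rule reval_Comp[where ys = "[g xs, h xs]"])
    show "reval rf [g xs, h xs] (f (g xs) (h xs))" using rf[of "[g xs, h xs]"] by simp
    show "\<forall>i<length [rg, rh]. reval ([rg, rh] ! i) xs ([g xs, h xs] ! i)"
      using rg rh that by (auto simp: less_Suc_eq)
  qed auto
  then show ?thesis unfolding evaluable_def by blast
qed

lemma evaluable_Suc: "evaluable k f \<Longrightarrow> evaluable k (\<lambda>xs. Suc (f xs))"
proof (rule evaluable_comp1[where f = Suc])
  have "reval Sc xs (Suc (xs ! 0))" if "length xs = 1" for xs
    using that reval_S by (cases xs) auto
  then show "evaluable 1 (\<lambda>xs. Suc (xs ! 0))" unfolding evaluable_def by blast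
qed

lemma evaluable_rec_hd:
  assumes "evaluable k a" "evaluable (Suc (Suc k)) (\<lambda>xs. g (tl (tl xs)) (xs ! 1) (xs ! 0))"
  shows "evaluable (Suc k) (\<lambda>xs. rec_nat (a (tl xs)) (g (tl xs)) (hd xs))"
proof -
  obtain ra rg where ra: "\<And>xs. length xs = k \<Longrightarrow> reval ra xs (a xs)"
    and rg: "\<And>xs. length xs = Suc (Suc k) \<Longrightarrow> reval rg xs (g (tl (tl xs)) (xs ! 1) (xs ! 0))"
    using assms unfolding evaluable_def by blast
  have "reval (Prim ra rg) (n # xs) (rec_nat (a xs) (g xs) n)" if "length xs = k" for xs n
  proof (induction n)
    case 0
    then show ?case using ra that by (auto intro: reval_Prim0)
  next
    case (Suc n)
    show ?case
    proof (rule reval_PrimS[OF Suc])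
      show "reval rg (rec_nat (a xs) (g xs) n # n # xs) (rec_nat (a xs) (g xs) (Suc n))"
        using rg[of "rec_nat (a xs) (g xs) n # n # xs"] that by simp
    qed
  qed
  then have "reval (Prim ra rg) xs (rec_nat (a (tl xs)) (g (tl xs)) (hd xs))" if "length xs = Suc k" for xs
    using that by (cases xs) auto
  then show ?thesis unfolding evaluable_def by blast
qed

lemma evaluable_rec1:
  assumes "evaluable 1 (\<lambda>xs. a (xs ! 0))" "evaluable 3 (\<lambda>xs. g (xs ! 2) (xs ! 1) (xs ! 0))"
  shows "evaluable 2 (\<lambda>xs. rec_nat (a (xs ! 1)) (g (xs ! 1)) (xs ! 0))"
proof -
  have "evaluable 3 (\<lambda>xs. g (tl (tl xs) ! 0) (xs ! 1) (xs ! 0))"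
    using assms(2) by (rule evaluable_cong) (simp add: nth_tl numeral_eq_Suc)
  then have "evaluable 2 (\<lambda>xs. rec_nat (a (tl xs ! 0)) (g (tl xs ! 0)) (hd xs))"
    using evaluable_rec_hd[of 1 "\<lambda>xs. a (xs ! 0)" "\<lambda>xs. g (xs ! 0)"] assms(1)
    by (simp add: numeral_eq_Suc)
  then show ?thesis
    by (rule evaluable_cong) (auto simp: nth_tl numeral_2_eq_2 length_Suc_conv)
qed

lemma evaluable_rec:
  assumes "evaluable 1 (\<lambda>xs. a (xs ! 0))" "evaluable 3 (\<lambda>xs. g (xs ! 2) (xs ! 1) (xs ! 0))"
    "evaluable k n" "evaluable k b"
  shows "evaluable k (\<lambda>xs. rec_nat (a (b xs)) (g (b xs)) (n xs))"
  using evaluable_comp2[OF evaluable_rec1[OF assms(1,2)] assms(3,4)] .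

lemma evaluable_add:
  assumes "evaluable k f" "evaluable k g" shows "evaluable k (\<lambda>xs. f xs + g xs)"
proof -
  have "evaluable k (\<lambda>xs. rec_nat (g xs) (\<lambda>_ r. Suc r) (f xs))"
    by (rule evaluable_rec[where a = "\<lambda>x. x"]) (intro evaluable_nth evaluable_Suc assms; simp)+
  moreover have "rec_nat m (\<lambda>_ r. Suc r) n = n + m" for m n by (induction n) auto
  ultimately show ?thesis by simp
qed

lemma evaluable_pred:
  assumes "evaluable k f" shows "evaluable k (\<lambda>xs. f xs - 1)"
proof -
  have "evaluable k (\<lambda>xs. rec_nat 0 (\<lambda>i r. i) (f xs))"
    by (rule evaluable_rec[where a = "\<lambda>x. 0" and b = f])
       (auto intro: evaluable_nth evaluable_zero assms)
  moreover have "rec_nat 0 (\<lambda>i r. i) n = n - 1" for n by (induction n) auto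
  ultimately show ?thesis by simp
qed

lemma evaluable_diff:
  assumes "evaluable k f" "evaluable k g" shows "evaluable k (\<lambda>xs. f xs - g xs)"
proof -
  have "evaluable k (\<lambda>xs. rec_nat (f xs) (\<lambda>_ r. r - 1) (g xs))"
    by (rule evaluable_rec[where a = "\<lambda>x. x"]) (intro evaluable_nth evaluable_pred assms; simp)+
  moreover have "rec_nat m (\<lambda>_ r. r - 1) n = m - n" for m n by (induction n) auto
  ultimately show ?thesis by simp
qed

lemma evaluable_triangle:
  assumes "evaluable k f" shows "evaluable k (\<lambda>xs. triangle (f xs))"
proof -
  have "evaluable k (\<lambda>xs. rec_nat 0 (\<lambda>i r. r + Suc i) (f xs))"
    by (rule evaluable_rec[where a = "\<lambda>x. 0" and b = f])
       (intro evaluable_nth evaluable_zero evaluable_add evaluable_Suc assms; simp)+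
  moreover have "rec_nat 0 (\<lambda>i r. r + Suc i) n = triangle n" for n by (induction n) auto
  ultimately show ?thesis by simp
qed

lemma evaluable_prod_encode:
  assumes "evaluable k f" "evaluable k g" shows "evaluable k (\<lambda>xs. prod_encode (f xs, g xs))"
  unfolding prod_encode_def prod.case by (intro evaluable_add evaluable_triangle assms)

text \<open>The largest \<open>r\<close> with \<open>triangle r\<close> at most the argument, that
  is, the diagonal on which \<open>prod_encode\<close> places it. The inner \<open>rec_nat\<close>
  only tests whether its last argument is zero.\<close>

definition diag_index :: "nat \<Rightarrow> nat" where
  "diag_index = rec_nat 0 (\<lambda>i r. rec_nat (Suc r) (\<lambda>_ _. r) (triangle (Suc r) - Suc i))"

lemma diag_index: "triangle (diag_index z) \<le> z \<and> z < triangle (Suc (diag_index z))"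
proof (induction z)
  case (Suc z)
  then show ?case
    by (cases "triangle (Suc (diag_index z)) - Suc z") (auto simp: diag_index_def)
qed (simp add: diag_index_def)

lemma prod_decode_diag:
  "prod_decode z = (z - triangle (diag_index z), diag_index z - (z - triangle (diag_index z)))"
proof -
  have "prod_encode (z - triangle (diag_index z), diag_index z - (z - triangle (diag_index z))) = z"
    using diag_index[of z] by (auto simp: prod_encode_def)
  then show ?thesis by (metis prod_encode_inverse)
qed

lemma evaluable_diag_index: "evaluable k f \<Longrightarrow> evaluable k (\<lambda>xs. diag_index (f xs))"
proof -
  assume f: "evaluable k f"
  have inner: "evaluable 3 (\<lambda>xs. rec_nat (Suc (xs ! 0)) (\<lambda>_ _. xs ! 0) (triangle (Suc (xs ! 0)) - Suc (xs ! 1)))"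
    by (rule evaluable_rec[where a = Suc and g = "\<lambda>r _ _. r"])
       (intro evaluable_nth evaluable_Suc evaluable_diff evaluable_triangle; simp)+
  show ?thesis unfolding diag_index_def
    by (rule evaluable_rec[where a = "\<lambda>x. 0" and b = f])
       (rule inner evaluable_zero f)+
qed

lemma evaluable_pfst: "evaluable k f \<Longrightarrow> evaluable k (\<lambda>xs. pfst (f xs))"
  unfolding prod_decode_diag fst_conv
  by (intro evaluable_diff evaluable_triangle evaluable_diag_index)

lemma evaluable_psnd: "evaluable k f \<Longrightarrow> evaluable k (\<lambda>xs. psnd (f xs))"
  unfolding prod_decode_diag snd_conv
  by (intro evaluable_diff evaluable_triangle evaluable_diag_index)

lemma total_recursive_iff: "total_recursive h \<longleftrightarrow> evaluable 1 (\<lambda>xs. h (xs ! 0))"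
proof -
  have "(\<forall>x. reval r [x] (h x)) \<longleftrightarrow> (\<forall>xs. length xs = 1 \<longrightarrow> reval r xs (h (xs ! 0)))" for r
    by (auto simp: length_Suc_conv)
  then show ?thesis unfolding total_recursive_def evaluable_def by simp
qed

subsection \<open>Functionals primitive recursive in an oracle\<close>

text \<open>All reductions below are total functionals of this kind, so computability becomes a
  syntactic check by the rules \<open>opr_intros\<close>. Pairing makes one numerical argument
  enough.\<close>

inductive opr :: "(baire \<Rightarrow> nat \<Rightarrow> nat) \<Rightarrow> bool" where
  opr_zero: "opr (\<lambda>p x. 0)"
| opr_succ: "opr (\<lambda>p x. Suc x)"
| opr_id: "opr (\<lambda>p x. x)"
| opr_query: "opr (\<lambda>p x. p x)"
| opr_fst: "opr (\<lambda>p x. pfst x)"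
| opr_snd: "opr (\<lambda>p x. psnd x)"
| opr_pair: "opr f \<Longrightarrow> opr g \<Longrightarrow> opr (\<lambda>p x. prod_encode (f p x, g p x))"
| opr_comp: "opr f \<Longrightarrow> opr g \<Longrightarrow> opr (\<lambda>p x. f p (g p x))"
| opr_prim: "opr a \<Longrightarrow> opr g \<Longrightarrow>
    opr (\<lambda>p z. rec_nat (a p (pfst z)) (\<lambda>i r. g p (prod_encode (pfst z, prod_encode (i, r)))) (psnd z))"

lemma opr_subst:
  assumes "opr f" "opr g" shows "opr (\<lambda>p. f (g p))"
  using assms(1)
proof (induction rule: opr.induct)
  case (opr_comp f h)
  show ?case by (rule opr.opr_comp[OF opr_comp.IH])
next
  case (opr_prim a h)
  show ?case by (rule opr.opr_prim[OF opr_prim.IH])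
next
  case (opr_pair f h)
  show ?case by (rule opr.opr_pair[OF opr_pair.IH])
qed (rule assms(2) opr_zero opr_succ opr_id opr_fst opr_snd)+

text \<open>Meant for functionals that ignore their oracle; the zero oracle is a
  placeholder.\<close>

lemma opr_total_recursive: "opr f \<Longrightarrow> total_recursive (f (\<lambda>_. 0))"
  unfolding total_recursive_iff
proof (induction rule: opr.induct)
  case (opr_comp f g)
  then show ?case using evaluable_comp1[of "f (\<lambda>_. 0)" 1 "\<lambda>xs. g (\<lambda>_. 0) (xs ! 0)"] by simp
next
  case (opr_prim a g)
  have "evaluable 3 (\<lambda>xs. g (\<lambda>_. 0) (prod_encode (xs ! 2, prod_encode (xs ! 1, xs ! 0))))"
    by (rule evaluable_comp1[of "g (\<lambda>_. 0)"]) (use opr_prim in \<open>simp_all add: evaluable_prod_encode evaluable_nth\<close>)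
  then show ?case
    by (rule evaluable_rec[where a = "a (\<lambda>_. 0)", OF opr_prim.IH(1)])
       (simp_all add: evaluable_pfst evaluable_psnd evaluable_nth)
qed (simp_all add: evaluable_zero evaluable_Suc evaluable_nth evaluable_pfst evaluable_psnd evaluable_prod_encode)

named_theorems opr_intros

declare opr_zero [opr_intros] opr_id [opr_intros] opr_pair [opr_intros]

lemma opr_Suc [opr_intros]: "opr f \<Longrightarrow> opr (\<lambda>p x. Suc (f p x))"
  by (rule opr_comp[OF opr_succ])

lemma opr_pfst [opr_intros]: "opr f \<Longrightarrow> opr (\<lambda>p x. pfst (f p x))"
  by (rule opr_comp[OF opr_fst])

lemma opr_psnd [opr_intros]: "opr f \<Longrightarrow> opr (\<lambda>p x. psnd (f p x))"
  by (rule opr_comp[OF opr_snd])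

lemma opr_oracle [opr_intros]: "opr f \<Longrightarrow> opr (\<lambda>p x. p (f p x))"
  by (rule opr_comp[OF opr_query])

lemma opr_const [opr_intros]: "opr (\<lambda>p x. c)"
  by (induction c) (rule opr_zero opr_Suc | assumption)+

lemma opr_rec [opr_intros]:
  assumes "opr a" "opr (\<lambda>p z. g p (pfst z) (pfst (psnd z)) (psnd (psnd z)))" "opr n"
  shows "opr (\<lambda>p x. rec_nat (a p x) (g p x) (n p x))"
  using opr_comp[OF opr_prim[OF assms(1,2)] opr_pair[OF opr_id assms(3)]] by simp

lemma opr_comp2:
  assumes "opr (\<lambda>p z. F p (pfst z) (psnd z))" "opr f" "opr g"
  shows "opr (\<lambda>p x. F p (f p x) (g p x))"
  using opr_comp[OF assms(1) opr_pair[OF assms(2,3)]] by simp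

lemma opr_add [opr_intros]:
  assumes "opr f" "opr g" shows "opr (\<lambda>p x. f p x + g p x)"
proof -
  have "rec_nat m (\<lambda>_ r. Suc r) n = m + n" for m n by (induction n) auto
  moreover have "opr (\<lambda>p x. rec_nat (f p x) (\<lambda>_ r. Suc r) (g p x))"
    by (intro opr_intros assms)
  ultimately show ?thesis by simp
qed

lemma opr_mult [opr_intros]:
  assumes "opr f" "opr g" shows "opr (\<lambda>p x. f p x * g p x)"
proof -
  have "rec_nat 0 (\<lambda>_ r. r + m) n = m * n" for m n by (induction n) auto
  moreover have "opr (\<lambda>p x. rec_nat 0 (\<lambda>_ r. r + f p x) (g p x))"
    by (intro opr_intros opr_comp[OF assms(1)] assms)
  ultimately show ?thesis by simp
qed

lemma opr_diff [opr_intros]: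
  assumes "opr f" "opr g" shows "opr (\<lambda>p x. f p x - g p x)"
proof -
  have pred: "rec_nat 0 (\<lambda>i _. i) n = n - 1" for n by (induction n) auto
  have "rec_nat m (\<lambda>_ r. rec_nat 0 (\<lambda>i _. i) r) n = m - n" for m n by (induction n) (auto simp: pred)
  moreover have "opr (\<lambda>p x. rec_nat (f p x) (\<lambda>_ r. rec_nat 0 (\<lambda>i _. i) r) (g p x))"
    by (intro opr_intros assms)
  ultimately show ?thesis by simp
qed

lemma opr_pow2 [opr_intros]:
  assumes "opr f" shows "opr (\<lambda>p x. 2 ^ f p x)"
proof -
  have "rec_nat 1 (\<lambda>_ r. 2 * r) n = (2::nat) ^ n" for n by (induction n) auto
  moreover have "opr (\<lambda>p x. rec_nat 1 (\<lambda>_ r. 2 * r) (f p x))"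
    by (intro opr_intros assms)
  ultimately show ?thesis by simp
qed

section \<open>Predicates decided by such functionals\<close>

definition oprb :: "(baire \<Rightarrow> nat \<Rightarrow> bool) \<Rightarrow> bool" where
  "oprb P \<longleftrightarrow> opr (\<lambda>p x. of_bool (P p x))"

lemma opr_of_bool [opr_intros]: "oprb P \<Longrightarrow> opr (\<lambda>p x. of_bool (P p x))"
  unfolding oprb_def .

lemma opr_if [opr_intros]:
  assumes "oprb P" "opr f" "opr g" shows "opr (\<lambda>p x. if P p x then f p x else g p x)"
proof -
  have "opr (\<lambda>p x. of_bool (P p x) * f p x + (1 - of_bool (P p x)) * g p x)"
    by (intro opr_intros assms)
  then show ?thesis by (rule back_subst[where P = opr]) (auto simp: fun_eq_iff)
qed

lemma oprb_zero_iff: 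
  assumes "opr f" shows "oprb (\<lambda>p x. f p x = 0)"
  unfolding oprb_def
  by (rule back_subst[where P = opr, of "\<lambda>p x. 1 - f p x"]) (auto simp: fun_eq_iff intro!: opr_intros assms)

lemma oprb_le [opr_intros]:
  assumes "opr f" "opr g" shows "oprb (\<lambda>p x. f p x \<le> g p x)"
  using oprb_zero_iff[OF opr_diff[OF assms]] by simp

lemma oprb_not [opr_intros]:
  assumes "oprb P" shows "oprb (\<lambda>p x. \<not> P p x)"
  using oprb_zero_iff[OF opr_of_bool[OF assms]] by simp

lemma oprb_conj [opr_intros]:
  assumes "oprb P" "oprb Q" shows "oprb (\<lambda>p x. P p x \<and> Q p x)"
  unfolding oprb_def of_bool_conj by (intro opr_intros assms)

lemma oprb_disj [opr_intros]:
  assumes "oprb P" "oprb Q" shows "oprb (\<lambda>p x. P p x \<or> Q p x)"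
  using oprb_not[OF oprb_conj[OF oprb_not[OF assms(1)] oprb_not[OF assms(2)]]] by simp

lemma oprb_imp [opr_intros]:
  assumes "oprb P" "oprb Q" shows "oprb (\<lambda>p x. P p x \<longrightarrow> Q p x)"
  using oprb_disj[OF oprb_not[OF assms(1)] assms(2)] unfolding imp_conv_disj .

lemma oprb_iff [opr_intros]:
  assumes "oprb P" "oprb Q" shows "oprb (\<lambda>p x. P p x = Q p x)"
  using oprb_conj[OF oprb_imp[OF assms] oprb_imp[OF assms(2,1)]]
  by (rule back_subst[where P = oprb]) (auto simp: fun_eq_iff)

lemma oprb_eq [opr_intros]:
  assumes "opr f" "opr g" shows "oprb (\<lambda>p x. f p x = g p x)"
  using oprb_conj[OF oprb_le[OF assms] oprb_le[OF assms(2,1)]]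
  by (rule back_subst[where P = oprb]) (auto simp: fun_eq_iff)

lemma oprb_const [opr_intros]: "oprb (\<lambda>p x. c)"
  unfolding oprb_def by (rule opr_const)

lemma oprb_if [opr_intros]:
  assumes "oprb C" "oprb P" "oprb Q" shows "oprb (\<lambda>p x. if C p x then P p x else Q p x)"
  using oprb_conj[OF oprb_imp[OF assms(1,2)] oprb_imp[OF oprb_not[OF assms(1)] assms(3)]]
  by (rule back_subst[where P = oprb]) (auto simp: fun_eq_iff)

lemma oprb_ex [opr_intros]:
  assumes "oprb (\<lambda>p z. P p (pfst z) (psnd z))" "opr n"
  shows "oprb (\<lambda>p x. \<exists>i<n p x. P p x i)"
proof -
  have eq: "rec_nat 0 (\<lambda>i r. if P p x i then 1 else r) m = of_bool (\<exists>i<m. P p x i)" for p x m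
    by (induction m) (auto simp: less_Suc_eq)
  have P: "oprb (\<lambda>p x. P p (f p x) (g p x))" if "opr f" "opr g" for f g
    using opr_comp2[OF assms(1)[unfolded oprb_def] that] unfolding oprb_def .
  have "opr (\<lambda>p x. rec_nat 0 (\<lambda>i r. if P p x i then 1 else r) (n p x))"
    by (intro opr_intros P assms(2))
  then show ?thesis unfolding eq oprb_def .
qed

lemma oprb_all [opr_intros]:
  assumes "oprb (\<lambda>p z. P p (pfst z) (psnd z))" "opr n"
  shows "oprb (\<lambda>p x. \<forall>i<n p x. P p x i)"
  using oprb_not[OF oprb_ex[OF oprb_not[OF assms(1)] assms(2)]] by simp

lemma oprb_comp:
  assumes "oprb P" "opr f" shows "oprb (\<lambda>p x. P p (f p x))"
  using opr_comp[OF assms(1)[unfolded oprb_def] assms(2)] unfolding oprb_def .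

lemma oprb_comp2:
  assumes "oprb (\<lambda>p z. P p (pfst z) (psnd z))" "opr f" "opr g"
  shows "oprb (\<lambda>p x. P p (f p x) (g p x))"
  using oprb_comp[OF assms(1) opr_pair[OF assms(2,3)]] by simp

lemma oprb_even [opr_intros]:
  assumes "opr f" shows "oprb (\<lambda>p x. even (f p x))"
proof -
  have "rec_nat (1 :: nat) (\<lambda>_ r. 1 - r) n = of_bool (even n)" for n by (induction n) auto
  moreover have "opr (\<lambda>p x. rec_nat 1 (\<lambda>_ r. 1 - r) (f p x))"
    by (intro opr_intros assms)
  ultimately show ?thesis unfolding oprb_def by simp
qed

lemma opr_div2 [opr_intros]:
  assumes "opr f" shows "opr (\<lambda>p x. f p x div 2)"
proof -
  have "rec_nat 0 (\<lambda>i r. if even i then r else Suc r) n = n div 2" for n :: nat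
    by (induction n) auto
  moreover have "opr (\<lambda>p x. rec_nat 0 (\<lambda>i r. if even i then r else Suc r) (f p x))"
    by (intro opr_intros assms)
  ultimately show ?thesis by simp
qed

lemma opr_funpow:
  assumes "opr (\<lambda>p x. f x)" "opr n" "opr a"
  shows "opr (\<lambda>p x. (f ^^ n p x) (a p x))"
proof -
  have "rec_nat a (\<lambda>_ r. f r) n = (f ^^ n) a" for a n by (induction n) auto
  moreover have "opr (\<lambda>p x. rec_nat (a p x) (\<lambda>_ r. f r) (n p x))"
    by (intro opr_intros assms opr_comp[OF assms(1)])
  ultimately show ?thesis by simp
qed

subsection \<open>Coded lists\<close>

definition tl_code :: "nat \<Rightarrow> nat" where "tl_code c = psnd (c - 1)"

text \<open>0 encodes an index beyond the end of the list.\<close>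
definition lookup_code :: "nat \<Rightarrow> nat \<Rightarrow> nat" where
  "lookup_code c i = (let d = (tl_code ^^ i) c in if d = 0 then 0 else Suc (pfst (d - 1)))"

lemma prod_decode_0 [simp]: "prod_decode 0 = (0, 0)"
  by (simp add: prod_decode_def prod_decode_aux.simps)

lemma tl_code_funpow: "(tl_code ^^ i) (list_encode xs) = list_encode (drop i xs)"
proof (induction i arbitrary: xs)
  case (Suc i)
  have "tl_code (list_encode xs) = list_encode (tl xs)"
    by (cases xs) (auto simp: tl_code_def)
  then show ?case using Suc by (simp add: funpow_Suc_right drop_Suc del: funpow.simps)
qed simp

lemma lookup_code: "lookup_code (list_encode xs) i = (if i < length xs then Suc (xs ! i) else 0)"
proof (cases "i < length xs")
  case True
  with Cons_nth_drop_Suc[OF True, symmetric] show ?thesis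
    by (simp add: lookup_code_def tl_code_funpow Let_def)
next
  case False
  then show ?thesis by (auto simp: lookup_code_def tl_code_funpow Let_def)
qed

lemma opr_tl_code [opr_intros]: "opr f \<Longrightarrow> opr (\<lambda>p x. tl_code (f p x))"
  unfolding tl_code_def by (intro opr_intros)

lemma opr_lookup_code [opr_intros]:
  "opr f \<Longrightarrow> opr g \<Longrightarrow> opr (\<lambda>p x. lookup_code (f p x) (g p x))"
  unfolding lookup_code_def Let_def by (intro opr_intros opr_funpow)

lemma opr_list_encode [opr_intros]:
  assumes "opr (\<lambda>p z. g p (pfst z) (psnd z))" "opr n"
  shows "opr (\<lambda>p x. list_encode (map (g p x) [0..<n p x]))"
proof -
  have eq: "rec_nat 0 (\<lambda>j r. Suc (prod_encode (f (m - Suc j), r))) m = list_encode (map f [0..<m])"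
    for f m
  proof -
    have "j \<le> m \<Longrightarrow> rec_nat 0 (\<lambda>j r. Suc (prod_encode (f (m - Suc j), r))) j
        = list_encode (map f [m - j..<m])" for j
      by (induction j) (auto simp: Suc_diff_Suc upt_conv_Cons)
    from this[of m] show ?thesis by simp
  qed
  have "opr (\<lambda>p x. rec_nat 0 (\<lambda>j r. Suc (prod_encode (g p x (n p x - Suc j), r))) (n p x))"
    by (intro opr_intros opr_comp2[OF assms(1)] opr_comp[OF assms(2)] assms(2))
  then show ?thesis unfolding eq .
qed

lemma opr_prefix_code [opr_intros]:
  assumes "opr (\<lambda>p z. g p (pfst z) (psnd z))" "opr n"
  shows "opr (\<lambda>p x. prefix_code (g p x) (n p x))"
  unfolding prefix_code_def by (rule opr_list_encode[OF assms])

subsection \<open>Finite approximations\<close>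

text \<open>The threshold form makes the approximation monotone in the prefix, which is what allows
  it to be evaluated on prefixes of unreliable oracles in \<open>opr_jump\<close>.\<close>
definition approximates :: "(nat \<Rightarrow> nat) \<Rightarrow> (baire \<Rightarrow> nat \<Rightarrow> nat) \<Rightarrow> bool" where
  "approximates h f \<longleftrightarrow> (\<forall>p x. \<exists>t. \<forall>k. h (prod_encode (x, prefix_code p k))
      = (if k < t then 0 else Suc (f p x)))"

lemma approximatesI:
  "(\<And>p x. \<exists>t. \<forall>k. h (prod_encode (x, prefix_code p k)) = (if k < t then 0 else Suc (f p x)))
    \<Longrightarrow> approximates h f"
  unfolding approximates_def by blast

lemma approximatesD:
  "approximates h f \<Longrightarrow> \<exists>t. \<forall>k. h (prod_encode (x, prefix_code p k)) = (if k < t then 0 else Suc (f p x))"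
  unfolding approximates_def by blast

lemma approximates_oracle_free: "approximates (\<lambda>z. Suc (f (pfst z))) (\<lambda>p. f)"
  by (rule approximatesI, rule exI[of _ 0]) simp

lemma approximates_query: "approximates (\<lambda>z. lookup_code (psnd z) (pfst z)) (\<lambda>p. p)"
  by (rule approximatesI, rule_tac x = "Suc x" in exI) (auto simp: prefix_code_def lookup_code)

lemma approximates_pair:
  assumes "approximates hf f" "approximates hg g"
  shows "approximates (\<lambda>z. if hf z = 0 \<or> hg z = 0 then 0 else Suc (prod_encode (hf z - 1, hg z - 1)))
    (\<lambda>p x. prod_encode (f p x, g p x))"
proof (rule approximatesI, goal_cases)
  case (1 p x)
  obtain t where "\<And>k. hf (prod_encode (x, prefix_code p k)) = (if k < t then 0 else Suc (f p x))"
    using approximatesD[OF assms(1)] by blast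
  moreover obtain u where "\<And>k. hg (prod_encode (x, prefix_code p k)) = (if k < u then 0 else Suc (g p x))"
    using approximatesD[OF assms(2)] by blast
  ultimately show ?case
    by (intro exI[of _ "max t u"]) auto
qed

lemma approximates_comp:
  assumes "approximates hf f" "approximates hg g"
  shows "approximates (\<lambda>z. if hg z = 0 then 0 else hf (prod_encode (hg z - 1, psnd z)))
    (\<lambda>p x. f p (g p x))"
proof (rule approximatesI, goal_cases)
  case (1 p x)
  obtain t where "\<And>k. hf (prod_encode (g p x, prefix_code p k)) = (if k < t then 0 else Suc (f p (g p x)))"
    using approximatesD[OF assms(1)] by blast
  moreover obtain u where "\<And>k. hg (prod_encode (x, prefix_code p k)) = (if k < u then 0 else Suc (g p x))"
    using approximatesD[OF assms(2)] by blast
  ultimately show ?case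
    by (intro exI[of _ "max t u"]) auto
qed

lemma approximates_prim:
  assumes "approximates ha a" "approximates hg g"
  shows "approximates (\<lambda>z. rec_nat (ha (prod_encode (pfst (pfst z), psnd z)))
      (\<lambda>i r. if r = 0 then 0 else
        hg (prod_encode (prod_encode (pfst (pfst z), prod_encode (i, r - 1)), psnd z))) (psnd (pfst z)))
    (\<lambda>p z. rec_nat (a p (pfst z)) (\<lambda>i r. g p (prod_encode (pfst z, prod_encode (i, r)))) (psnd z))"
proof (rule approximatesI)
  fix p x
  define y where "y = pfst x"
  define R where "R = rec_nat (a p y) (\<lambda>i r. g p (prod_encode (y, prod_encode (i, r))))"
  define H where "H k = rec_nat (ha (prod_encode (y, prefix_code p k)))
      (\<lambda>i r. if r = 0 then 0 else
        hg (prod_encode (prod_encode (y, prod_encode (i, r - 1)), prefix_code p k)))" for k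
  have "\<exists>t. \<forall>k. H k n = (if k < t then 0 else Suc (R n))" for n
  proof (induction n)
    case 0
    show ?case using approximatesD[OF assms(1), of y p] unfolding H_def R_def by auto
  next
    case (Suc n)
    then obtain t where t: "\<And>k. H k n = (if k < t then 0 else Suc (R n))" by blast
    obtain u where u: "\<And>k. hg (prod_encode (prod_encode (y, prod_encode (n, R n)), prefix_code p k))
        = (if k < u then 0 else Suc (g p (prod_encode (y, prod_encode (n, R n)))))"
      using approximatesD[OF assms(2)] by blast
    have "H k (Suc n) = (if H k n = 0 then 0 else
        hg (prod_encode (prod_encode (y, prod_encode (n, H k n - 1)), prefix_code p k)))" for k
      unfolding H_def by simp
    then show ?case using u
      by (intro exI[of _ "max t u"]) (auto simp: t R_def)
  qed
  then show "\<exists>t. \<forall>k. rec_nat (ha (prod_encode (pfst (pfst (prod_encode (x, prefix_code p k))),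
          psnd (prod_encode (x, prefix_code p k)))))
      (\<lambda>i r. if r = 0 then 0 else
        hg (prod_encode (prod_encode (pfst (pfst (prod_encode (x, prefix_code p k))), prod_encode (i, r - 1)),
            psnd (prod_encode (x, prefix_code p k))))) (psnd (pfst (prod_encode (x, prefix_code p k))))
      = (if k < t then 0 else Suc (rec_nat (a p (pfst x))
          (\<lambda>i r. g p (prod_encode (pfst x, prod_encode (i, r)))) (psnd x)))"
    unfolding H_def R_def y_def prod_encode_inverse fst_conv snd_conv by blast
qed

lemma opr_approximates:
  assumes "opr f" shows "\<exists>h. opr (\<lambda>_. h) \<and> approximates h f"
proof -
  have oracle_free: "\<exists>h. opr (\<lambda>_. h) \<and> approximates h (\<lambda>_. f)" if "opr (\<lambda>_. f)" for f
  proof -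
    have "opr (\<lambda>_ z. Suc (f (pfst z)))" by (intro opr_intros opr_comp[OF that])
    then show ?thesis using approximates_oracle_free by blast
  qed
  from assms show ?thesis
  proof (induction rule: opr.induct)
    case opr_query
    have "opr (\<lambda>_ z. lookup_code (psnd z) (pfst z))" by (intro opr_intros)
    then show ?case using approximates_query by blast
  next
    case (opr_pair f g)
    then obtain hf hg where h: "opr (\<lambda>_. hf)" "approximates hf f" "opr (\<lambda>_. hg)" "approximates hg g"
      by blast
    have "opr (\<lambda>_ z. if hf z = 0 \<or> hg z = 0 then 0 else Suc (prod_encode (hf z - 1, hg z - 1)))"
      by (intro opr_intros h)
    then show ?case using approximates_pair[OF h(2,4)] by blast
  next
    case (opr_comp f g)
    then obtain hf hg where h: "opr (\<lambda>_. hf)" "approximates hf f" "opr (\<lambda>_. hg)" "approximates hg g"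
      by blast
    have "opr (\<lambda>_ z. if hg z = 0 then 0 else hf (prod_encode (hg z - 1, psnd z)))"
      by (intro opr_intros h opr.opr_comp[OF h(1)])
    then show ?case using approximates_comp[OF h(2,4)] by blast
  next
    case (opr_prim a g)
    then obtain ha hg where h: "opr (\<lambda>_. ha)" "approximates ha a" "opr (\<lambda>_. hg)" "approximates hg g"
      by blast
    have "opr (\<lambda>_ z. rec_nat (ha (prod_encode (pfst (pfst z), psnd z)))
        (\<lambda>i r. if r = 0 then 0 else
          hg (prod_encode (prod_encode (pfst (pfst z), prod_encode (i, r - 1)), psnd z))) (psnd (pfst z)))"
      by (intro opr_intros h opr.opr_comp[OF h(1)] opr.opr_comp[OF h(3)])
    then show ?case using approximates_prim[OF h(2,4)] by blast
  qed (rule oracle_free, intro opr_intros)+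
qed

lemma opr_computable:
  assumes "opr f" shows "computable (\<lambda>p. Some (f p))"
proof -
  obtain h where h: "opr (\<lambda>_. h)" "approximates h f"
    using opr_approximates[OF assms] by blast
  have "total_recursive h" using opr_total_recursive[OF h(1)] .
  moreover have "(\<exists>k. h (prod_encode (n, prefix_code p k)) = Suc (f p n)) \<and>
      (\<forall>k v. h (prod_encode (n, prefix_code p k)) = Suc v \<longrightarrow> v = f p n)" for p n
  proof -
    obtain t where "\<And>k. h (prod_encode (n, prefix_code p k)) = (if k < t then 0 else Suc (f p n))"
      using approximatesD[OF h(2)] by blast
    then show ?thesis by (auto intro: exI[of _ t])
  qed
  ultimately show ?thesis unfolding computable_def by auto
qed

subsection \<open>Limits\<close>

lemma limB_iff:
  "limB q = Some p \<longleftrightarrow> (\<forall>m. \<exists>N. \<forall>i\<ge>N. q (prod_encode (m, i)) = p m)"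
proof -
  have the: "(THE v. \<exists>N. \<forall>i\<ge>N. q (prod_encode (m, i)) = v) = v"
    if "\<exists>N. \<forall>i\<ge>N. q (prod_encode (m, i)) = v" for m v
  proof (rule the_equality)
    show "\<exists>N. \<forall>i\<ge>N. q (prod_encode (m, i)) = v" using that .
  next
    fix w assume "\<exists>N. \<forall>i\<ge>N. q (prod_encode (m, i)) = w"
    with that obtain N N' where "\<forall>i\<ge>N. q (prod_encode (m, i)) = w" "\<forall>i\<ge>N'. q (prod_encode (m, i)) = v"
      by blast
    from this[THEN spec, of "max N N'"] show "w = v" by simp
  qed
  show ?thesis (is "_ \<longleftrightarrow> ?R")
  proof
    assume "limB q = Some p"
    then have ex: "\<forall>m. \<exists>v N. \<forall>i\<ge>N. q (prod_encode (m, i)) = v"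
      and p: "p = (\<lambda>m. THE v. \<exists>N. \<forall>i\<ge>N. q (prod_encode (m, i)) = v)"
      unfolding limB_def by (auto split: if_splits)
    show ?R
    proof
      fix m
      obtain v where v: "\<exists>N. \<forall>i\<ge>N. q (prod_encode (m, i)) = v" using ex by blast
      then show "\<exists>N. \<forall>i\<ge>N. q (prod_encode (m, i)) = p m" unfolding p the[OF v] .
    qed
  next
    assume R: ?R
    then have "(\<lambda>m. THE v. \<exists>N. \<forall>i\<ge>N. q (prod_encode (m, i)) = v) = p"
      using the by blast
    moreover have "\<forall>m. \<exists>v N. \<forall>i\<ge>N. q (prod_encode (m, i)) = v" using R by blast
    ultimately show "limB q = Some p" unfolding limB_def by simp
  qed
qed

primrec limn :: "nat \<Rightarrow> baire \<Rightarrow> baire option" where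
  "limn 0 p = Some p"
| "limn (Suc n) p = Option.bind (limB p) (limn n)"

lemma jump_rep_funpow: "(jump_rep ^^ n) d p = Option.bind (limn n p) d"
proof (induction n arbitrary: p)
  case (Suc n)
  show ?case by (cases "limB p") (auto simp: jump_rep_def Suc[unfolded jump_rep_def])
qed simp

text \<open>\<open>limn\<close> peels off the first limit, whereas the regions are computed by
  appending a limit after the last one.\<close>

lemma limn_Suc: "limn n p = Some q \<Longrightarrow> limB q = Some r \<Longrightarrow> limn (Suc n) p = Some r"
proof (induction n arbitrary: p)
  case (Suc n)
  then show ?case by (cases "limB p") auto
qed simp

lemma limn_chain:
  assumes "limn n p = Some c"
  obtains q where "q 0 = p" "q n = c" "\<And>j. j < n \<Longrightarrow> limB (q j) = Some (q (Suc j))"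
  using assms
proof (induction n arbitrary: p thesis)
  case 0
  show ?case by (rule "0.prems"(1)[of "\<lambda>_. p"]) (use 0 in auto)
next
  case (Suc n)
  then obtain p' where p': "limB p = Some p'" "limn n p' = Some c" by (auto simp: bind_eq_Some_conv)
  obtain q where q: "q 0 = p'" "q n = c" "\<And>j. j < n \<Longrightarrow> limB (q j) = Some (q (Suc j))"
    using Suc.IH[OF _ p'(2)] by blast
  show ?case
    by (rule Suc.prems(1)[of "case_nat p q"]) (use p' q in \<open>auto split: nat.splits\<close>)
qed

text \<open>Evaluating a functional at stage \<open>i\<close> on the length-\<open>i\<close> prefix of the \<open>i\<close>-th
  approximation of its oracle commutes with the limit, as the use of the oracle is finite.\<close>

lemma opr_jump:
  assumes "opr f"
  obtains f' where "opr f'" "\<And>q p. limB q = Some p \<Longrightarrow> limB (f' q) = Some (f p)"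
proof -
  obtain h where h: "opr (\<lambda>_. h)" "approximates h f"
    using opr_approximates[OF assms] by blast
  define f' where "f' q z = h (prod_encode (pfst z,
      prefix_code (\<lambda>m. q (prod_encode (m, psnd z))) (psnd z))) - 1" for q z
  have "opr f'" unfolding f'_def by (intro opr_intros opr_comp[OF h(1)])
  moreover have "limB (f' q) = Some (f p)" if lim: "limB q = Some p" for q p
    unfolding limB_iff
  proof
    fix x
    obtain t where t: "\<And>k. h (prod_encode (x, prefix_code p k)) = (if k < t then 0 else Suc (f p x))"
      using approximatesD[OF h(2)] by blast
    obtain N where N: "\<And>m i. i \<ge> N m \<Longrightarrow> q (prod_encode (m, i)) = p m"
      using lim unfolding limB_iff by metis
    define M where "M = Max (insert t (N ` {..<t}))"
    have M: "t \<le> M" "\<And>m. m < t \<Longrightarrow> N m \<le> M" unfolding M_def by auto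
    have "f' q (prod_encode (x, i)) = f p x" if i: "i \<ge> M" for i
    proof -
      define p' where "p' m = q (prod_encode (m, i))" for m
      \<comment> \<open>The oracle \<open>p'\<close> of stage \<open>i\<close> may still be wrong
        beyond \<open>t\<close>. As \<open>h\<close> already answers on the common prefix of length
        \<open>t\<close>, its threshold \<open>u\<close> for \<open>p'\<close> is at most
        \<open>t\<close>, and the answer still stands at length \<open>i\<close>.\<close>
      have "prefix_code p' t = prefix_code p t"
        unfolding prefix_code_def p'_def
        by (intro arg_cong[of _ _ list_encode] map_cong refl N order_trans[OF M(2) i]) simp
      moreover obtain u where u: "\<And>k. h (prod_encode (x, prefix_code p' k)) = (if k < u then 0 else Suc (f p' x))"
        using approximatesD[OF h(2)] by blast
      ultimately have "u \<le> t" "f p' x = f p x"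
        using t[of t] u[of t] by (auto split: if_splits)
      then show ?thesis using u[of i] M(1) i unfolding f'_def p'_def by simp
    qed
    then show "\<exists>N. \<forall>i\<ge>N. f' q (prod_encode (x, i)) = f p x" by blast
  qed
  ultimately show thesis by (rule that)
qed

lemma opr_limn:
  assumes "opr f"
  shows "\<exists>f'. opr f' \<and> (\<forall>q p. limn n q = Some p \<longrightarrow> limn n (f' q) = Some (f p))"
proof (induction n)
  case 0
  show ?case using assms by auto
next
  case (Suc n)
  then obtain f1 where f1: "opr f1" "\<And>q p. limn n q = Some p \<Longrightarrow> limn n (f1 q) = Some (f p)" by blast
  obtain f2 where f2: "opr f2" "\<And>q p. limB q = Some p \<Longrightarrow> limB (f2 q) = Some (f1 p)"
    using opr_jump[OF f1(1)] by blast
  have "limn (Suc n) (f2 q) = Some (f p)" if "limn (Suc n) q = Some p" for q p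
    using that f2(2) f1(2) by (auto simp: bind_eq_Some_conv)
  with f2(1) show ?case by blast
qed

subsection \<open>Coded words\<close>

lemma nat_of_word_tl: "(nat_of_word w - 1) div 2 = nat_of_word (tl w)"
  by (cases w) auto

lemma nat_of_word_eq_0_iff [simp]: "nat_of_word w = 0 \<longleftrightarrow> w = []"
  by (cases w) auto

lemma inj_nat_of_word: "nat_of_word v = nat_of_word w \<Longrightarrow> v = w"
proof (induction v arbitrary: w)
  case (Cons b v)
  then obtain c w' where w: "w = c # w'" by (cases w) (auto split: if_splits)
  with Cons.prems have "b = c \<and> nat_of_word v = nat_of_word w'"
    by (auto split: if_splits) presburger+
  with w Cons.IH show ?case by auto
next
  case Nil
  then show ?case by (metis nat_of_word_eq_0_iff)
qed

lemma surj_nat_of_word: "\<exists>w. nat_of_word w = N"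
proof (induction N rule: less_induct)
  case (less N)
  show ?case
  proof (cases "N = 0")
    case False
    then obtain w where w: "nat_of_word w = (N - 1) div 2" using less[of "(N - 1) div 2"] by fastforce
    have "nat_of_word (even N # w) = N" using False unfolding nat_of_word.simps w
      by (cases "even N") (auto elim!: oddE evenE)
    then show ?thesis by blast
  qed (auto intro: exI[of _ "[]"])
qed

definition word_of :: "nat \<Rightarrow> bool list" where
  "word_of N = (THE w. nat_of_word w = N)"

lemma word_of_nat_of_word [simp]: "word_of (nat_of_word w) = w"
  unfolding word_of_def by (rule the_equality) (auto dest: inj_nat_of_word)

lemma nat_of_word_word_of [simp]: "nat_of_word (word_of N) = N"
  using surj_nat_of_word[of N] by auto

lemma length_le_nat_of_word: "length w \<le> nat_of_word w"
  by (induction w) auto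

lemma nat_of_word_snoc: "nat_of_word (w @ [b]) = nat_of_word w + 2 ^ length w * (if b then 2 else 1)"
  by (induction w) auto

definition tl_word :: "nat \<Rightarrow> nat" where "tl_word N = (N - 1) div 2"

lemma tl_word_funpow: "(tl_word ^^ i) (nat_of_word w) = nat_of_word (drop i w)"
proof (induction i arbitrary: w)
  case (Suc i)
  have "tl_word (nat_of_word w) = nat_of_word (tl w)"
    by (simp add: tl_word_def nat_of_word_tl[simplified])
  then show ?case using Suc by (simp add: funpow_Suc_right drop_Suc del: funpow.simps)
qed simp

text \<open>The value False beyond the end turns a word into an infinite play, so that notions for
  plays apply to positions as well.\<close>

definition bit_at :: "bool list \<Rightarrow> nat \<Rightarrow> bool" where
  "bit_at w i \<longleftrightarrow> i < length w \<and> w ! i"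

lemma bit_at_code: "bit_at (word_of N) i \<longleftrightarrow> (tl_word ^^ i) N \<noteq> 0 \<and> even ((tl_word ^^ i) N)"
proof -
  define w where "w = word_of N"
  have N: "N = nat_of_word w" unfolding w_def by simp
  show ?thesis
  proof (cases "i < length w")
    case True
    with Cons_nth_drop_Suc[OF True, symmetric] show ?thesis
      unfolding N by (simp add: tl_word_funpow bit_at_def)
  qed (simp add: N tl_word_funpow bit_at_def)
qed

lemma length_word_of: "length (word_of N) = rec_nat 0 (\<lambda>i r. if (tl_word ^^ i) N = 0 then r else Suc i) N"
proof -
  have "rec_nat 0 (\<lambda>i r. if (tl_word ^^ i) (nat_of_word w) = 0 then r else Suc i) k = min k (length w)"
    for w k
    unfolding tl_word_funpow by (induction k) auto
  from this[of "word_of N" N] show ?thesis using length_le_nat_of_word[of "word_of N"] by simp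
qed

lemma opr_tl_word [opr_intros]: "opr f \<Longrightarrow> opr (\<lambda>p x. tl_word (f p x))"
  unfolding tl_word_def by (intro opr_intros)

lemma oprb_bit_at [opr_intros]:
  "opr f \<Longrightarrow> opr g \<Longrightarrow> oprb (\<lambda>p x. bit_at (word_of (f p x)) (g p x))"
  unfolding bit_at_code by (intro opr_intros opr_funpow)

lemma opr_length_word [opr_intros]:
  assumes "opr f" shows "opr (\<lambda>p x. length (word_of (f p x)))"
  unfolding length_word_of by (intro opr_intros opr_funpow opr_comp[OF assms] assms)

lemma opr_snoc [opr_intros]:
  "opr f \<Longrightarrow> oprb b \<Longrightarrow> opr (\<lambda>p x. nat_of_word (word_of (f p x) @ [b p x]))"
  unfolding nat_of_word_snoc nat_of_word_word_of by (intro opr_intros)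

definition is_prefix :: "bool list \<Rightarrow> bool list \<Rightarrow> bool" where
  "is_prefix u w \<longleftrightarrow> length u \<le> length w \<and> (\<forall>i<length u. bit_at u i = bit_at w i)"

lemma oprb_is_prefix [opr_intros]:
  assumes "opr f" "opr g" shows "oprb (\<lambda>p x. is_prefix (word_of (f p x)) (word_of (g p x)))"
  unfolding is_prefix_def by (intro opr_intros assms opr_comp[OF assms(1)] opr_comp[OF assms(2)])

lemma is_prefix_snoc: "is_prefix u w \<Longrightarrow> is_prefix u (w @ [b])"
  unfolding is_prefix_def bit_at_def by (auto simp: nth_append)

lemma in_cyl_iff_prefix: "in_cyl u x \<longleftrightarrow> (\<exists>k. is_prefix u (map x [0..<k]))"
proof
  assume "in_cyl u x"
  then have "is_prefix u (map x [0..<length u])"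
    unfolding in_cyl_def is_prefix_def bit_at_def by auto
  then show "\<exists>k. is_prefix u (map x [0..<k])" by blast
next
  assume "\<exists>k. is_prefix u (map x [0..<k])"
  then show "in_cyl u x" unfolding in_cyl_def is_prefix_def bit_at_def by force
qed

subsection \<open>Layered reachability games\<close>

text \<open>The one-step controllable predecessor of reachability games, for the player who moves at
  the positions in \<open>ow\<close>.\<close>

definition attr :: "(bool list \<Rightarrow> bool) \<Rightarrow> (bool list \<Rightarrow> bool) \<Rightarrow> bool list \<Rightarrow> bool" where
  "attr ow X w = (if ow w then X (w @ [False]) \<or> X (w @ [True]) else X (w @ [False]) \<and> X (w @ [True]))"

text \<open>The guard \<open>nat_of_word w \<le> i\<close> keeps every stage finite without changing the union.\<close>
primrec stage ::
  "(bool list \<Rightarrow> bool) \<Rightarrow> (nat \<Rightarrow> bool list \<Rightarrow> bool) \<Rightarrow> (bool list \<Rightarrow> bool) \<Rightarrow> nat \<Rightarrow> bool list \<Rightarrow> bool" where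
  "stage ow cv Q 0 w = False"
| "stage ow cv Q (Suc i) w =
    (nat_of_word w \<le> i \<and> \<not> Q w \<and> (cv i w \<or> attr ow (stage ow cv Q i) w))"

text \<open>Ties go to False. As stages grow, the answer is final once either successor has been
  reached.\<close>

definition first_true where
  "first_true ow cv Q i w \<longleftrightarrow>
    (\<exists>j<Suc i. stage ow cv Q j (w @ [True]) \<and> \<not> stage ow cv Q j (w @ [False]))"

text \<open>The recommended move at \<open>w\<close>, as 0 (not yet known), 1 (False) or 2 (True): the owner
  goes to the successor that is reached first, the other player avoids it.\<close>
definition response where
  "response ow cv Q i w = (if stage ow cv Q i (w @ [False]) \<or> stage ow cv Q i (w @ [True])
     then if first_true ow cv Q i w = ow w then 2 else 1 else (0 :: nat))"

lemma attr_mono: "attr ow X w \<Longrightarrow> (\<And>v. X v \<Longrightarrow> Y v) \<Longrightarrow> attr ow Y w"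
  unfolding attr_def by (auto split: if_splits)

lemma stage_mono:
  assumes "\<And>i w. cv i w \<Longrightarrow> cv (Suc i) w" "i \<le> j" "stage ow cv Q i w"
  shows "stage ow cv Q j w"
proof -
  have "stage ow cv Q i w \<Longrightarrow> stage ow cv Q (Suc i) w" for i w
  proof (induction i arbitrary: w)
    case (Suc i)
    have "cv i w \<Longrightarrow> cv (Suc i) w" using assms(1) .
    moreover have "attr ow (stage ow cv Q i) w \<Longrightarrow> attr ow (stage ow cv Q (Suc i)) w"
      by (erule attr_mono) (rule Suc.IH)
    ultimately show ?case using Suc.prems unfolding stage.simps by auto
  qed simp
  with assms(2,3) show ?thesis by (induction rule: dec_induct) auto
qed

text \<open>\<open>own g w\<close> means that the mover at \<open>w\<close> is the player who
  profits from layer \<open>g\<close>, and \<open>cov g i w\<close> that by stage \<open>i\<close>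
  the position \<open>w\<close> is seen to lie inside the union of the open sets up to
  \<open>g\<close>. This explains the monotonicity in all three arguments of
  \<open>cov\<close>.\<close>

locale layered_game =
  fixes own :: "nat \<Rightarrow> bool list \<Rightarrow> bool" and cov :: "nat \<Rightarrow> nat \<Rightarrow> bool list \<Rightarrow> bool" and top :: nat
  assumes own_Suc: "own (Suc g) w \<longleftrightarrow> \<not> own g w"
    and cov_stage: "cov g i w \<Longrightarrow> cov g (Suc i) w"
    and cov_layer: "cov g i w \<Longrightarrow> cov (Suc g) i w"
    and cov_snoc: "cov g i w \<Longrightarrow> cov g i (w @ [b])"
    and cov_top: "cov top i w"
begin

text \<open>\<open>region (g + 1)\<close> is the set of positions from which the owner of layer \<open>g\<close> wins
  by the layers up to \<open>g\<close> alone.\<close>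
primrec region :: "nat \<Rightarrow> bool list \<Rightarrow> bool" where
  "region 0 w = False"
| "region (Suc g) w = (\<exists>i. stage (own g) (cov g) (region g) i w)"

declare region.simps(2) [simp del]

abbreviation "stg g \<equiv> stage (own g) (cov g) (region g)"

lemma stg_mono: "i \<le> j \<Longrightarrow> stg g i w \<Longrightarrow> stg g j w"
  by (rule stage_mono) (auto intro: cov_stage)

lemma region_SucI: "stg g i w \<Longrightarrow> region (Suc g) w"
  unfolding region.simps by blast

lemma region_SucE: "region (Suc g) w \<Longrightarrow> (\<And>i. stg g i w \<Longrightarrow> thesis) \<Longrightarrow> thesis"
  unfolding region.simps by blast

text \<open>Finite branching makes \<open>\<omega>\<close> stages reach the fixed point: two
  successors that are both reached are reached by a common stage, and the guard in
  \<open>stage\<close> is met by waiting.\<close>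

lemma region_Suc_iff:
  "region (Suc g) w \<longleftrightarrow> \<not> region g w \<and> ((\<exists>i. cov g i w) \<or> attr (own g) (region (Suc g)) w)"
proof
  assume "region (Suc g) w"
  then obtain i where i: "stg g i w" by (rule region_SucE)
  then obtain j where "\<not> region g w" "cov g j w \<or> attr (own g) (stg g j) w" by (cases i) auto
  then show "\<not> region g w \<and> ((\<exists>i. cov g i w) \<or> attr (own g) (region (Suc g)) w)"
    using attr_mono[of "own g" "stg g j" w "region (Suc g)"] region_SucI by blast
next
  assume R: "\<not> region g w \<and> ((\<exists>i. cov g i w) \<or> attr (own g) (region (Suc g)) w)"
  have cov_le: "cov g i w \<Longrightarrow> i \<le> j \<Longrightarrow> cov g j w" for i j
    by (rotate_tac, induction rule: dec_induct) (auto intro: cov_stage)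
  have "\<exists>i. cov g i w \<or> attr (own g) (stg g i) w"
  proof (cases "\<exists>i. cov g i w")
    case False
    with R have at: "attr (own g) (region (Suc g)) w" by blast
    show ?thesis
    proof (cases "own g w")
      case True
      with at show ?thesis unfolding attr_def by (auto elim!: region_SucE)
    next
      case False
      with at obtain i j where "stg g i (w @ [False])" "stg g j (w @ [True])"
        unfolding attr_def by (auto elim!: region_SucE)
      then have "stg g (max i j) (w @ [False])" "stg g (max i j) (w @ [True])"
        by (auto elim!: stg_mono[rotated])
      with False show ?thesis unfolding attr_def by auto
    qed
  qed auto
  then obtain i where i: "cov g i w \<or> attr (own g) (stg g i) w" by blast
  define j where "j = max i (nat_of_word w)"
  have "cov g j w \<or> attr (own g) (stg g j) w"
    using i cov_le[of i j] attr_mono[of "own g" "stg g i" w "stg g j"] stg_mono[of i j] unfolding j_def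
    by auto
  then have "stg g (Suc j) w" using R unfolding j_def by simp
  then show "region (Suc g) w" by (rule region_SucI)
qed

lemma region_disjoint: "region g w \<Longrightarrow> \<not> region (Suc g) w"
  using region_Suc_iff by blast

text \<open>\<open>region g\<close> and \<open>region (g + 2)\<close> belong to the same player, who
  can reuse the forcing play: until it is covered it stays in \<open>region g\<close>, hence outside
  \<open>region (g + 1)\<close>.\<close>

lemma region_step2: "region g w \<Longrightarrow> region (Suc (Suc g)) w"
proof (cases g)
  case (Suc h)
  assume "region g w"
  then obtain i where "stg h i w" using Suc by (auto elim: region_SucE)
  then have "region (Suc (Suc (Suc h))) w"
  proof (induction i arbitrary: w)
    case (Suc i)
    have "\<not> region (Suc (Suc h)) w" using region_disjoint region_SucI Suc.prems by blast
    moreover have "(\<exists>i. cov (Suc (Suc h)) i w) \<or> attr (own (Suc (Suc h))) (region (Suc (Suc (Suc h)))) w"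
    proof (cases "cov h i w")
      case False
      with Suc.prems have "attr (own h) (stg h i) w" by simp
      then have "attr (own (Suc (Suc h))) (stg h i) w" unfolding attr_def own_Suc by simp
      then show ?thesis using Suc.IH attr_mono by blast
    qed (auto intro: cov_layer)
    ultimately show ?case using region_Suc_iff[of "Suc (Suc h)" w] by blast
  qed simp
  then show ?thesis using Suc by simp
qed simp

lemma region_parity:
  assumes "region g w" "g \<le> h" shows "region h w \<longleftrightarrow> even (h - g)"
proof -
  have ev: "region (g + 2 * k) w" for k
    by (induction k) (use assms(1) region_step2 in auto)
  obtain k where "h = g + 2 * k \<or> h = Suc (g + 2 * k)"
    using assms(2) by (metis add.assoc add_Suc_right le_Suc_ex oddE evenE plus_1_eq_Suc add.commute)
  then show ?thesis using ev[of k] region_disjoint[OF ev[of k]] by auto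
qed

lemma region_top: "\<not> region top w \<Longrightarrow> region (Suc top) w"
  using region_Suc_iff[of top w] cov_top by blast

section \<open>Labels, ranks, and the outcome of plays that respect them\<close>

definition label :: "bool list \<Rightarrow> nat" where
  "label w = (LEAST g. region (Suc g) w)"

lemma region_label: "region (Suc (label w)) w"
  and label_le_top: "label w \<le> top"
  and not_region_label: "g \<le> label w \<Longrightarrow> \<not> region g w"
proof -
  have ex: "\<exists>g\<le>top. region (Suc g) w"
  proof (cases "region top w")
    case True
    then obtain h where "top = Suc h" by (cases top) auto
    with True show ?thesis by (intro exI[of _ h]) simp
  qed (use region_top in blast)
  then show "region (Suc (label w)) w" unfolding label_def by (auto intro: LeastI)
  show "label w \<le> top" using ex unfolding label_def by (meson Least_le order_trans)
  show "\<not> region g w" if "g \<le> label w"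
    using that not_less_Least[of "g - 1" "\<lambda>g. region (Suc g) w"] unfolding label_def
    by (cases g) auto
qed

lemma label_le: "region (Suc g) w \<Longrightarrow> label w \<le> g"
  unfolding label_def by (rule Least_le)

lemma label_parity: "region (Suc g) w \<Longrightarrow> even (label w) = even g"
  using region_parity[OF region_label, of w "Suc g"] label_le[of g w] by auto

definition rank :: "nat \<Rightarrow> bool list \<Rightarrow> nat" where
  "rank g w = (LEAST i. stg g i w)"

lemma stg_iff_rank: "region (Suc g) w \<Longrightarrow> stg g i w \<longleftrightarrow> rank g w \<le> i"
  unfolding rank_def by (metis LeastI Least_le region_SucE stg_mono)

text \<open>A covered position enters its region without attraction, so a reason is needed why the
  owner can stay there. With \<open>g\<close> the label, \<open>w\<close> is in neither
  \<open>region g\<close> nor the region before it. Hence the opponent cannot force the next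
  position into \<open>region g\<close>, as \<open>w\<close> would then belong to it. Avoiding
  \<open>region g\<close> is enough, since successors stay covered.\<close>

lemma covered_progress:
  assumes "\<exists>i. cov (label w) i w"
  shows "attr (own (label w)) (region (Suc (label w))) w"
proof -
  define g where "g = label w"
  have "\<not> region g w" "\<And>h. g = Suc h \<Longrightarrow> \<not> region h w"
    using not_region_label unfolding g_def by auto
  then have "attr (own g) (\<lambda>v. \<not> region g v) w"
  proof (cases g)
    case (Suc h)
    then have "\<not> attr (own h) (region g) w"
      using \<open>\<not> region g w\<close> \<open>\<And>h. g = Suc h \<Longrightarrow> \<not> region h w\<close> region_Suc_iff[of h w] by auto
    moreover have "attr (own g) (\<lambda>v. \<not> region g v) w \<longleftrightarrow> \<not> attr (own h) (region g) w"
      unfolding attr_def using own_Suc Suc by simp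
    ultimately show ?thesis by simp
  qed (auto simp: attr_def)
  moreover have "region (Suc g) (w @ [b])" if "\<not> region g (w @ [b])" for b
    using assms that cov_snoc region_Suc_iff[of g] unfolding g_def by blast
  ultimately show ?thesis unfolding g_def by (auto elim: attr_mono simp: attr_def split: if_splits)
qed

lemma uncovered_progress:
  assumes "\<not> (\<exists>i. cov (label w) i w)"
  shows "attr (own (label w)) (\<lambda>v. region (Suc (label w)) v \<and> rank (label w) v < rank (label w) w) w"
proof -
  define g where "g = label w"
  have r: "region (Suc g) w" using region_label unfolding g_def .
  then have "stg g (rank g w) w" using stg_iff_rank by blast
  then obtain i where i: "rank g w = Suc i" "attr (own g) (stg g i) w"
    using assms unfolding g_def[symmetric] by (cases "rank g w") auto
  have "region (Suc g) v \<and> rank g v < rank g w" if "stg g i v" for v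
    using stg_iff_rank[OF region_SucI[OF that], of i] that i(1) region_SucI[OF that] by simp
  then show ?thesis using i(2) unfolding g_def[symmetric] by (auto elim: attr_mono)
qed

lemma region_progress: "attr (own (label w)) (region (Suc (label w))) w"
  using covered_progress uncovered_progress attr_mono by (cases "\<exists>i. cov (label w) i w") blast+

text \<open>One profile for both players: it is constrained only where the mover is the player who
  wins from \<open>w\<close>. The falling rank keeps an uncovered play from lingering in its region
  forever.\<close>

definition sound :: "(bool list \<Rightarrow> bool) \<Rightarrow> bool" where
  "sound s \<longleftrightarrow> (\<forall>w. own (label w) w \<longrightarrow> region (Suc (label w)) (w @ [s w]) \<and>
     ((\<exists>i. cov (label w) i w) \<or> rank (label w) (w @ [s w]) < rank (label w) w))"

lemma own_parity: "even g = even h \<Longrightarrow> own g w = own h w"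
proof -
  have "own g w = (if even g then own 0 w else \<not> own 0 w)" for g
    by (induction g) (auto simp: own_Suc)
  then show "even g = even h \<Longrightarrow> own g w = own h w" by simp
qed

text \<open>Along the play the label never increases and keeps its parity, so it settles at some
  \<open>g\<close>. Were the play never covered by layer \<open>g\<close>, the rank would fall
  forever. Were it covered by a smaller layer, this would persist and put late positions into a
  region below their label. So \<open>g\<close> is the least layer covering the play, and its parity
  is that of the label of the root.\<close>

lemma sound_play:
  assumes "sound s" and play: "\<And>k. own (label []) (map x [0..<k]) \<Longrightarrow> x k = s (map x [0..<k])"
  shows "\<exists>g\<le>top. even g = even (label []) \<and> (\<exists>k i. cov g i (map x [0..<k])) \<and>
    (\<forall>h<g. \<forall>k i. \<not> cov h i (map x [0..<k]))"
proof -
  define v where "v k = map x [0..<k]" for k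
  have v_Suc: "v (Suc k) = v k @ [x k]" for k unfolding v_def by simp
  have step': "region (Suc (label (v k))) (v (Suc k)) \<and> ((\<exists>i. cov (label (v k)) i (v k)) \<or>
      rank (label (v k)) (v (Suc k)) < rank (label (v k)) (v k))"
    if "even (label (v k)) = even (label [])" for k
  proof (cases "own (label (v k)) (v k)")
    case True
    have "x k = s (v k)" using play True own_parity[OF that] unfolding v_def by blast
    then show ?thesis using assms(1) True unfolding v_Suc sound_def by simp
  next
    case False
    then show ?thesis using region_progress[of "v k"] uncovered_progress[of "v k"]
      unfolding v_Suc attr_def by (cases "x k") auto
  qed
  have parity: "even (label (v k)) = even (label [])" for k
  proof (induction k)
    case (Suc k)
    then show ?case using label_parity step'[OF Suc] by metis
  qed (simp add: v_def)
  note step = step'[OF parity]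
  have dec: "label (v (Suc k)) \<le> label (v k)" for k
    using step label_le by blast
  obtain K where K: "\<And>k. label (v K) \<le> label (v k)"
    using ex_has_least_nat[of "\<lambda>_. True" 0 "\<lambda>k. label (v k)"] by auto
  define g where "g = label (v K)"
  have stable: "label (v k) = g" if "k \<ge> K" for k
  proof (rule antisym)
    show "label (v k) \<le> g" unfolding g_def using that lift_Suc_antimono_le[of "\<lambda>k. label (v k)" K k] dec
      by blast
  qed (use K g_def in simp)
  have "\<exists>k i. cov g i (v k)"
  proof (rule ccontr)
    assume neg: "\<not> ?thesis"
    have "rank g (v (Suc k)) < rank g (v k)" if "k \<ge> K" for k
      using step[of k] stable[OF that] neg by auto
    then have "rank g (v (K + j)) + j \<le> rank g (v K)" for j
      by (induction j) (auto simp: less_eq_Suc_le intro: le_trans[rotated])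
    from this[of "Suc (rank g (v K))"] show False by simp
  qed
  moreover have "\<not> cov h i (v k)" if "h < g" for h k i
  proof
    assume cov: "cov h i (v k)"
    obtain f where f: "g = Suc f" "h \<le> f" using \<open>h < g\<close> by (cases g) auto
    from f(2) cov have "cov f i (v k)" by (induction rule: dec_induct) (auto intro: cov_layer)
    then have "cov f i (v (k + j))" for j
      by (induction j) (auto simp: v_Suc intro: cov_snoc)
    from this[of K] have "cov f i (v (k + K))" .
    moreover have "label (v (k + K)) = g" using stable by simp
    ultimately have "region (Suc f) (v (k + K))"
      using not_region_label[of f "v (k + K)"] f region_Suc_iff[of f "v (k + K)"] by auto
    then show False using not_region_label[of g "v (k + K)"] \<open>label (v (k + K)) = g\<close> f by auto
  qed
  moreover have "g \<le> top" unfolding g_def by (rule label_le_top)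
  ultimately show ?thesis using parity[of K] unfolding v_def[symmetric] g_def by blast
qed

section \<open>Moves read off from finite stages\<close>

abbreviation "resp g \<equiv> response (own g) (cov g) (region g)"

lemma response_eq_0_iff: "resp g i w = 0 \<longleftrightarrow> \<not> stg g i (w @ [False]) \<and> \<not> stg g i (w @ [True])"
  unfolding response_def by auto

lemma response_stable:
  assumes "resp g i w \<noteq> 0" "i \<le> j"
  shows "resp g j w = resp g i w"
proof -
  have "first_true (own g) (cov g) (region g) j w = first_true (own g) (cov g) (region g) i w"
    using assms stg_mono unfolding response_eq_0_iff first_true_def
    by (smt (verit) less_Suc_eq_le nat_le_linear order_trans)
  moreover have "resp g j w \<noteq> 0"
    using assms stg_mono unfolding response_eq_0_iff by blast
  ultimately show ?thesis using assms(1) unfolding response_def by (auto split: if_splits)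
qed

text \<open>The successor reached first has the least rank, so if any successor lowers the rank, the
  recommended one does.\<close>

lemma response_own:
  assumes "resp g i w \<noteq> 0" "own g w" "b = (resp g i w = 2)"
  shows "region (Suc g) (w @ [b]) \<and> (region (Suc g) (w @ [c]) \<longrightarrow> rank g (w @ [b]) \<le> rank g (w @ [c]))"
proof -
  have b: "b = first_true (own g) (cov g) (region g) i w"
    using assms unfolding response_def by (auto split: if_splits)
  show ?thesis
  proof (cases b)
    case True
    then obtain j where j: "stg g j (w @ [True])" "\<not> stg g j (w @ [False])"
      using b unfolding first_true_def by blast
    then have "region (Suc g) (w @ [True])" by (auto intro: region_SucI)
    moreover have "rank g (w @ [True]) \<le> j" using j calculation stg_iff_rank by blast
    moreover have "region (Suc g) (w @ [False]) \<Longrightarrow> rank g (w @ [True]) \<le> rank g (w @ [False])"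
      using j stg_iff_rank calculation(2) by (meson nat_le_linear order_trans)
    ultimately show ?thesis using True by (cases c) (auto simp del: region.simps)
  next
    case False
    then have nf: "\<And>j. j \<le> i \<Longrightarrow> stg g j (w @ [True]) \<Longrightarrow> stg g j (w @ [False])"
      using b unfolding first_true_def by auto
    then have F: "stg g i (w @ [False])" using assms(1) unfolding response_eq_0_iff by auto
    then have rF: "region (Suc g) (w @ [False])" "rank g (w @ [False]) \<le> i"
      using region_SucI stg_iff_rank by blast+
    have "rank g (w @ [False]) \<le> rank g (w @ [True])" if "region (Suc g) (w @ [True])"
      using nf[of "rank g (w @ [True])"] rF stg_iff_rank that
      by (meson le_cases order_trans order_refl)
    then show ?thesis using False rF by (cases c) auto
  qed
qed

lemma response_other:
  assumes "resp g i w \<noteq> 0" "\<not> own g w" "b = (resp g i w = 2)"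
  shows "region (Suc g) (w @ [\<not> b])"
proof -
  have b: "(\<not> b) = first_true (own g) (cov g) (region g) i w"
    using assms unfolding response_def by (auto split: if_splits)
  show ?thesis
  proof (cases b)
    case False
    then show ?thesis using b unfolding first_true_def by (auto intro: region_SucI)
  next
    case True
    then show ?thesis using b assms(1) unfolding first_true_def response_eq_0_iff
      by (auto intro: region_SucI)
  qed
qed

text \<open>Up to label \<open>n\<close> the mover's own layer supplies the response. At label
  \<open>n + 1\<close> the mover opposes layer \<open>n\<close>, and everything is covered, so only
  \<open>region (n + 1)\<close> must be avoided. If an obedient move still entered it, the sibling
  would lie in it too by \<open>response_other\<close>, and no successor would be left in
  \<open>region (n + 2)\<close>, against \<open>region_progress\<close>.\<close>

lemma sound_if_follows_responses:
  assumes "top = Suc n"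
    and follows: "\<And>w i. resp (min n (label w)) i w \<noteq> 0 \<Longrightarrow> s w = (resp (min n (label w)) i w = 2)"
  shows "sound s"
  unfolding sound_def
proof (intro allI impI)
  fix w assume own: "own (label w) w"
  define g where "g = label w"
  have at: "region (Suc g) (w @ [False]) \<or> region (Suc g) (w @ [True])"
    using region_progress[of w] own unfolding g_def attr_def by simp
  show "region (Suc (label w)) (w @ [s w]) \<and>
      ((\<exists>i. cov (label w) i w) \<or> rank (label w) (w @ [s w]) < rank (label w) w)"
  proof (cases "g \<le> n")
    case True
    obtain i where i: "resp g i w \<noteq> 0" using at unfolding response_eq_0_iff by (auto elim!: region_SucE)
    have s: "s w = (resp g i w = 2)" using follows[of w i] i True unfolding g_def by (simp add: min_def)
    have o: "own g w" using own unfolding g_def .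
    show ?thesis
    proof (cases "\<exists>i. cov g i w")
      case True
      then show ?thesis using response_own[OF i o s] unfolding g_def by auto
    next
      case False
      then obtain c where "region (Suc g) (w @ [c])" "rank g (w @ [c]) < rank g w"
        using uncovered_progress[of w] o unfolding g_def attr_def by (auto split: if_splits)
      then show ?thesis using response_own[OF i o s, of c] unfolding g_def by auto
    qed
  next
    case False
    then have g: "g = Suc n" using label_le_top[of w] assms(1) unfolding g_def by simp
    have no: "\<not> own n w" using own own_Suc g unfolding g_def by auto
    have "region (Suc g) (w @ [s w])"
    proof (rule ccontr)
      assume neg: "\<not> region (Suc g) (w @ [s w])"
      then have "region (Suc n) (w @ [s w])" using region_top g assms(1) by metis
      then obtain i where "stg n i (w @ [s w])" by (rule region_SucE)
      then have i: "resp n i w \<noteq> 0" unfolding response_eq_0_iff by (cases "s w") auto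
      then have "s w = (resp n i w = 2)" using follows[of w i] g unfolding g_def by simp
      then have "region (Suc n) (w @ [\<not> s w])" using response_other[OF i no] by blast
      then have "\<not> region (Suc g) (w @ [\<not> s w])" using region_disjoint g by blast
      with neg at show False by (cases "s w") auto
    qed
    then show ?thesis using cov_top g assms(1) unfolding g_def by auto
  qed
qed

end

text \<open>\<open>stage\<close> recurs at longer words, so the recursion on \<open>i\<close>
  carries a coded table of the whole previous stage, which the guard in \<open>stage\<close> keeps
  finite. A lookup gives 2 for true, 1 for false and 0 outside the table, where the stage is false
  as well.\<close>

lemma oprb_stage:
  assumes ow: "oprb (\<lambda>p z. ow p (word_of z))" and cv: "oprb (\<lambda>p z. cv p (pfst z) (word_of (psnd z)))"
    and Q: "oprb (\<lambda>p z. Q p (word_of z))" and f: "opr f" and g: "opr g"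
  shows "oprb (\<lambda>p x. stage (ow p) (cv p) (Q p) (f p x) (word_of (g p x)))"
proof -
  define look where "look t w b = (lookup_code t (nat_of_word (w @ [b])) = 2)" for t w b
  define step where "step p i t N = (\<not> Q p (word_of N) \<and> (cv p i (word_of N) \<or>
      (if ow p (word_of N) then look t (word_of N) False \<or> look t (word_of N) True
       else look t (word_of N) False \<and> look t (word_of N) True)))" for p i t N
  define tab where "tab p = rec_nat 0 (\<lambda>i t. list_encode (map (\<lambda>N. of_bool (step p i t N)) [0..<Suc i]))" for p
  have tab: "lookup_code (tab p i) (nat_of_word w) = 2 \<longleftrightarrow> stage (ow p) (cv p) (Q p) i w" for p i w
  proof (induction i arbitrary: w)
    case 0
    have "lookup_code 0 k = 0" for k using lookup_code[of "[]" k] by simp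
    then show ?case by (simp add: tab_def)
  next
    case (Suc i)
    have l: "look (tab p i) w b = stage (ow p) (cv p) (Q p) i (w @ [b])" for w b
      unfolding look_def Suc.IH ..
    have "tab p (Suc i) = list_encode (map (\<lambda>N. of_bool (step p i (tab p i) N)) [0..<Suc i])"
      by (simp add: tab_def)
    then have "lookup_code (tab p (Suc i)) (nat_of_word w) = 2 \<longleftrightarrow>
        nat_of_word w \<le> i \<and> step p i (tab p i) (nat_of_word w)"
      by (auto simp: lookup_code less_Suc_eq_le simp del: upt_Suc)
    then show ?case unfolding step_def l by (simp add: attr_def)
  qed
  have look_opr: "oprb (\<lambda>p x. look (t p x) (word_of (N p x)) b)" if "opr t" "opr N" for t N b
    unfolding look_def by (intro opr_intros that)
  have step_opr: "oprb (\<lambda>p x. step p (i p x) (t p x) (N p x))" if "opr i" "opr t" "opr N" for i t N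
    unfolding step_def by (intro opr_intros look_opr that oprb_comp[OF ow] oprb_comp2[OF cv] oprb_comp[OF Q])
  have tab_opr: "opr (\<lambda>p x. tab p (f p x))" if "opr f" for f
    unfolding tab_def by (intro opr_intros that step_opr)
  show ?thesis unfolding tab[symmetric] nat_of_word_word_of
    by (intro opr_intros tab_opr f g)
qed

lemma opr_response:
  assumes ow: "oprb (\<lambda>p z. ow p (word_of z))" and cv: "oprb (\<lambda>p z. cv p (pfst z) (word_of (psnd z)))"
    and Q: "oprb (\<lambda>p z. Q p (word_of z))" and f: "opr f" and g: "opr g"
  shows "opr (\<lambda>p x. response (ow p) (cv p) (Q p) (f p x) (word_of (g p x)))"
proof -
  have st: "oprb (\<lambda>p x. stage (ow p) (cv p) (Q p) (i p x) (word_of (N p x) @ [b]))"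
    if "opr i" "opr N" for i N b
    using oprb_stage[OF ow cv Q that(1), of "\<lambda>p x. nat_of_word (word_of (N p x) @ [b])"]
      opr_snoc[OF that(2) oprb_const] by simp
  show ?thesis unfolding response_def first_true_def
    by (intro opr_intros st oprb_comp[OF ow] opr_comp[OF f] opr_comp[OF g] f g)
qed

subsection \<open>Games in the difference hierarchy\<close>

definition turn :: "baire \<Rightarrow> bool list \<Rightarrow> nat" where
  "turn p w = p (2 * nat_of_word w)"

definition covered :: "baire \<Rightarrow> nat \<Rightarrow> nat \<Rightarrow> bool list \<Rightarrow> bool" where
  "covered p g i w \<longleftrightarrow> (\<exists>b<Suc g. \<exists>k<i. p (2 * prod_encode (b, k) + 1) \<noteq> 0 \<and>
     is_prefix (word_of (p (2 * prod_encode (b, k) + 1) - 1)) w)"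

text \<open>With \<open>n + 1\<close> open sets, plays of least index \<open>g\<close> are won by
  player 1 iff \<open>g\<close> and \<open>n\<close> have equal parity. For
  \<open>g = n + 1\<close>, the plays in no set, this correctly gives player 2.\<close>

definition owner :: "nat \<Rightarrow> baire \<Rightarrow> nat \<Rightarrow> bool list \<Rightarrow> bool" where
  "owner n p g w \<longleftrightarrow> (turn p w = 1) = even (g + n)"

text \<open>An extra layer \<open>n + 1\<close> covering everything accounts for the plays in none of the open sets.\<close>
definition cover :: "nat \<Rightarrow> baire \<Rightarrow> nat \<Rightarrow> nat \<Rightarrow> bool list \<Rightarrow> bool" where
  "cover n p g i w \<longleftrightarrow> n < g \<or> covered p g i w"

interpretation game: layered_game "owner n p" "cover n p" "Suc n" for n p
proof
  show "owner n p (Suc g) w \<longleftrightarrow> \<not> owner n p g w" for g w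
    unfolding owner_def by auto
  show "cover n p g i w \<Longrightarrow> cover n p g (Suc i) w" for g i w
    unfolding cover_def covered_def by (meson less_SucI)
  show "cover n p g i w \<Longrightarrow> cover n p (Suc g) i w" for g i w
    unfolding cover_def covered_def by (meson less_SucI)
  show "cover n p g i w \<Longrightarrow> cover n p g i (w @ [b])" for g i w b
    unfolding cover_def covered_def using is_prefix_snoc by metis
  show "cover n p (Suc n) i w" for i w unfolding cover_def by simp
qed

lemma rep_game_Dm:
  "rep_game (rep_Dm m) p = Some G \<longleftrightarrow> (\<forall>k. p (2 * k) \<in> {1, 2}) \<and>
    G = (turn p, Dm_set m (\<lambda>b. open_of (projB b (sndB p))))"
  unfolding rep_game_def rep_Dm_def fstB_def turn_def by auto

lemma mem_open_of_projB:
  "x \<in> open_of (projB b (sndB p)) \<longleftrightarrow> (\<exists>i k. p (2 * prod_encode (b, i) + 1) \<noteq> 0 \<and>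
    is_prefix (word_of (p (2 * prod_encode (b, i) + 1) - 1)) (map x [0..<k]))"
proof -
  have "(\<exists>w. c = Suc (nat_of_word w) \<and> in_cyl w x) \<longleftrightarrow> c \<noteq> 0 \<and> in_cyl (word_of (c - 1)) x" for c
    by (cases c) (auto intro: exI[of _ "word_of (c - 1)"])
  then show ?thesis unfolding open_of_def projB_def sndB_def in_cyl_iff_prefix by auto
qed

lemma mem_Dm_set:
  assumes "g \<le> m" "g < m \<Longrightarrow> x \<in> U g" "\<And>b. b < g \<Longrightarrow> x \<notin> U b"
  shows "x \<in> Dm_set m U \<longleftrightarrow> g mod 2 \<noteq> m mod 2"
proof (cases "g < m")
  case True
  have "(LEAST b. x \<in> U b) = g"
    by (rule Least_equality) (use assms True in \<open>auto simp: not_less[symmetric]\<close>)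
  with True assms show ?thesis unfolding Dm_set_def by auto
next
  case False
  with assms have "g = m" "\<forall>b<m. x \<notin> U b" by auto
  then show ?thesis unfolding Dm_set_def by (auto simp: not_less)
qed

lemma sound_imp_winning:
  assumes p: "rep_game (rep_Dm (Suc n)) p = Some G" and s: "game.sound n p s"
  shows "winning G (if even (game.label n p [] + n) then 1 else 2) s"
proof -
  define U where "U b = open_of (projB b (sndB p))" for b
  have G: "G = (turn p, Dm_set (Suc n) U)" and d: "\<And>w. turn p w \<in> {1, 2}"
    using p unfolding rep_game_Dm U_def turn_def by auto
  define i :: nat where "i = (if even (game.label n p [] + n) then 1 else 2)"
  have main: "x \<in> Dm_set (Suc n) U \<longleftrightarrow> i = 1" if x: "consistent (turn p) i s x" for x
  proof -
    have "x k = s (map x [0..<k])" if "owner n p (game.label n p []) (map x [0..<k])" for k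
    proof -
      have "turn p (map x [0..<k]) = i"
        using that d[of "map x [0..<k]"] unfolding owner_def i_def by auto
      then show ?thesis using x unfolding consistent_def by blast
    qed
    from game.sound_play[OF s this] obtain g where g: "g \<le> Suc n"
      "even g = even (game.label n p [])" "\<exists>k i. cover n p g i (map x [0..<k])"
      "\<And>h k i. h < g \<Longrightarrow> \<not> cover n p h i (map x [0..<k])"
      by auto
    have notU: "x \<notin> U b" if "b < g" for b
    proof
      assume "x \<in> U b"
      then obtain i k where "p (2 * prod_encode (b, i) + 1) \<noteq> 0"
        "is_prefix (word_of (p (2 * prod_encode (b, i) + 1) - 1)) (map x [0..<k])"
        unfolding U_def mem_open_of_projB by blast
      then have "cover n p b (Suc i) (map x [0..<k])"
        unfolding cover_def covered_def by blast
      with g(4)[OF that] show False by blast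
    qed
    have inU: "x \<in> U g" if less: "g < Suc n"
    proof -
      obtain k j where "covered p g j (map x [0..<k])"
        using g(3) less unfolding cover_def by auto
      then obtain b i where b: "b \<le> g" "p (2 * prod_encode (b, i) + 1) \<noteq> 0"
        "is_prefix (word_of (p (2 * prod_encode (b, i) + 1) - 1)) (map x [0..<k])"
        unfolding covered_def by (auto simp: less_Suc_eq_le)
      then have "x \<in> U b" unfolding U_def mem_open_of_projB by blast
      with notU b(1) show ?thesis by (cases "b = g") auto
    qed
    have "x \<in> Dm_set (Suc n) U \<longleftrightarrow> g mod 2 \<noteq> Suc n mod 2"
      by (rule mem_Dm_set) (use g(1) inU notU in auto)
    also have "\<dots> \<longleftrightarrow> i = 1"
      using g(2) unfolding i_def by (cases "even g"; cases "even n") (simp_all add: mod2_eq_if)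
    finally show ?thesis .
  qed
  have "i \<in> {1, 2}" unfolding i_def by simp
  then show ?thesis using main unfolding G winning_def i_def[symmetric] by auto
qed

subsection \<open>Computing the regions with iterated limits\<close>

definition settled :: "(nat \<Rightarrow> nat) \<Rightarrow> nat" where
  "settled r = (if \<exists>i. r i \<noteq> 0 then r (LEAST i. r i \<noteq> 0) else 0)"

lemma settled_eq:
  assumes "\<And>i j. r i \<noteq> 0 \<Longrightarrow> i \<le> j \<Longrightarrow> r j = r i" "r i \<noteq> 0"
  shows "settled r = r i"
  using assms(1)[of "LEAST i. r i \<noteq> 0" i] LeastI[of "\<lambda>i. r i \<noteq> 0" i] Least_le[of "\<lambda>i. r i \<noteq> 0" i] assms(2)
  unfolding settled_def by auto

definition advice :: "nat \<Rightarrow> baire \<Rightarrow> nat \<Rightarrow> bool list \<Rightarrow> nat" where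
  "advice n p g w = settled (\<lambda>i. response (owner n p g) (cover n p g) (game.region n p g) i w)"

text \<open>What \<open>g\<close> limits provide: section 0 keeps the name, which later stages query
  again, section 1 decides \<open>region g\<close>, and the others hold the final responses at
  labels below \<open>g\<close>. Such a response is never 0, so 0 signals a label of at least
  \<open>g\<close>.\<close>

definition data :: "nat \<Rightarrow> baire \<Rightarrow> nat \<Rightarrow> baire" where
  "data n p g z = (if pfst z = 0 then p (psnd z)
     else if pfst z = 1 then of_bool (game.region n p g (word_of (psnd z)))
     else if game.label n p (word_of (psnd z)) < g
       then advice n p (game.label n p (word_of (psnd z))) (word_of (psnd z)) else 0)"

definition known_name :: "baire \<Rightarrow> baire" where
  "known_name D x = D (prod_encode (0, x))"

definition known_region :: "baire \<Rightarrow> bool list \<Rightarrow> bool" where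
  "known_region D w \<longleftrightarrow> D (prod_encode (1, nat_of_word w)) = 1"

definition next_stage :: "nat \<Rightarrow> nat \<Rightarrow> baire \<Rightarrow> nat \<Rightarrow> bool list \<Rightarrow> bool" where
  "next_stage n g D = stage (owner n (known_name D) g) (covered (known_name D) g) (known_region D)"

definition next_response :: "nat \<Rightarrow> nat \<Rightarrow> baire \<Rightarrow> nat \<Rightarrow> bool list \<Rightarrow> nat" where
  "next_response n g D = response (owner n (known_name D) g) (covered (known_name D) g) (known_region D)"

text \<open>A position without a response has label at least \<open>g\<close>, and it has label
  \<open>g\<close> exactly if some stage contains it. Until then the response is withheld, so that
  the limit is 0 at larger labels.\<close>

definition next_data :: "nat \<Rightarrow> nat \<Rightarrow> baire \<Rightarrow> baire" where
  "next_data n g D z = (if pfst (pfst z) = 0 then D (pfst z)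
     else if pfst (pfst z) = 1 then of_bool (next_stage n g D (psnd z) (word_of (psnd (pfst z))))
     else if D (pfst z) \<noteq> 0 then D (pfst z)
     else if next_stage n g D (psnd z) (word_of (psnd (pfst z)))
       then next_response n g D (psnd z) (word_of (psnd (pfst z))) else 0)"

lemma advice_eq:
  assumes "response (owner n p g) (cover n p g) (game.region n p g) i w \<noteq> 0"
  shows "advice n p g w = response (owner n p g) (cover n p g) (game.region n p g) i w"
  unfolding advice_def by (rule settled_eq) (use assms game.response_stable in blast)+

lemma known_data:
  assumes "g \<le> n"
  shows "known_name (data n p g) = p" "known_region (data n p g) = game.region n p g"
    "next_stage n g (data n p g) = stage (owner n p g) (cover n p g) (game.region n p g)"
    "next_response n g (data n p g) = response (owner n p g) (cover n p g) (game.region n p g)"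
proof -
  show 1: "known_name (data n p g) = p"
    unfolding known_name_def data_def by auto
  show 2: "known_region (data n p g) = game.region n p g"
    unfolding known_region_def data_def by auto
  have 3: "cover n p g = covered p g" using assms unfolding cover_def by auto
  show "next_stage n g (data n p g) = stage (owner n p g) (cover n p g) (game.region n p g)"
    "next_response n g (data n p g) = response (owner n p g) (cover n p g) (game.region n p g)"
    unfolding next_stage_def next_response_def 1 2 3 by auto
qed

lemma label_response:
  "\<exists>i. response (owner n p (game.label n p w)) (cover n p (game.label n p w))
     (game.region n p (game.label n p w)) i w \<noteq> 0"
  using game.region_progress[of n p w] unfolding attr_def game.response_eq_0_iff
  by (auto elim!: game.region_SucE split: if_splits)

lemma advice_label_neq_0: "advice n p (game.label n p w) w \<noteq> 0"
  using label_response advice_eq by metis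

lemma limB_next_data:
  assumes "g \<le> n"
  shows "limB (next_data n g (data n p g)) = Some (data n p (Suc g))"
  unfolding limB_iff
proof
  fix z
  define w where "w = word_of (psnd z)"
  let ?st = "stage (owner n p g) (cover n p g) (game.region n p g)"
  let ?re = "response (owner n p g) (cover n p g) (game.region n p g)"
  have next_data: "next_data n g (data n p g) (prod_encode (z, i)) =
     (if pfst z = 0 then data n p g z else if pfst z = 1 then of_bool (?st i w)
      else if data n p g z \<noteq> 0 then data n p g z else if ?st i w then ?re i w else 0)" for i
    unfolding next_data_def known_data[OF assms] w_def by simp
  have st: "\<exists>N. \<forall>i\<ge>N. ?st i w = game.region n p (Suc g) w"
    using game.stg_mono[of _ _ n p g w] game.region_SucI[of n p g] by (metis game.region_SucE)
  show "\<exists>N. \<forall>i\<ge>N. next_data n g (data n p g) (prod_encode (z, i)) = data n p (Suc g) z"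
  proof (cases "pfst z \<le> 1")
    case True
    then consider "pfst z = 0" | "pfst z = 1" by linarith
    then show ?thesis
    proof cases
      case 2
      then have "data n p (Suc g) z = of_bool (game.region n p (Suc g) w)" by (simp add: data_def w_def)
      with 2 st show ?thesis unfolding next_data by auto
    qed (simp add: next_data data_def)
  next
    case False
    then have d: "data n p h z = (if game.label n p w < h then advice n p (game.label n p w) w else 0)" for h
      by (auto simp: data_def w_def)
    have nd: "next_data n g (data n p g) (prod_encode (z, i)) =
        (if game.label n p w < g then advice n p (game.label n p w) w else if ?st i w then ?re i w else 0)" for i
      using False advice_label_neq_0[of n p w] unfolding next_data d by auto
    consider "game.label n p w < g" | "game.label n p w = g" | "game.label n p w > g" by linarith
    then show ?thesis
    proof cases
      case 1
      then show ?thesis unfolding nd d by simp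
    next
      case 2
      then obtain j where j: "?re j w \<noteq> 0" using label_response[of n p w] by auto
      have re: "?re i w = advice n p g w" if "i \<ge> j" for i
        using game.response_stable[OF j that] advice_eq[OF j] by simp
      obtain N where N: "\<And>i. i \<ge> N \<Longrightarrow> ?st i w" using st game.region_label[of n p w] 2 by auto
      show ?thesis unfolding nd d using 2 N re by (intro exI[of _ "max N j"]) auto
    next
      case 3
      then have "\<not> game.region n p (Suc g) w" using game.not_region_label by auto
      then have "\<not> ?st i w" for i using game.region_SucI by blast
      then show ?thesis unfolding nd d using 3 by auto
    qed
  qed
qed

lemma opr_known_name [opr_intros]: "opr f \<Longrightarrow> opr (\<lambda>D x. known_name D (f D x))"
  unfolding known_name_def by (intro opr_intros)

lemma oprb_known_region: "oprb (\<lambda>D z. known_region D (word_of z))"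
  unfolding known_region_def nat_of_word_word_of by (intro opr_intros)

lemma oprb_owner: "oprb (\<lambda>D z. owner n (known_name D) g (word_of z))"
  unfolding owner_def turn_def nat_of_word_word_of by (intro opr_intros)

lemma oprb_covered: "oprb (\<lambda>D z. covered (known_name D) g (pfst z) (word_of (psnd z)))"
  unfolding covered_def by (intro opr_intros)

lemma oprb_next_stage [opr_intros]:
  "opr i \<Longrightarrow> opr N \<Longrightarrow> oprb (\<lambda>D x. next_stage n g D (i D x) (word_of (N D x)))"
  unfolding next_stage_def by (rule oprb_stage[OF oprb_owner oprb_covered oprb_known_region])

lemma opr_next_response [opr_intros]:
  "opr i \<Longrightarrow> opr N \<Longrightarrow> opr (\<lambda>D x. next_response n g D (i D x) (word_of (N D x)))"
  unfolding next_response_def by (rule opr_response[OF oprb_owner oprb_covered oprb_known_region])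

lemma opr_next_data: "opr (next_data n g)"
proof -
  have "opr (\<lambda>D x. next_data n g D x)"
    unfolding next_data_def by (intro opr_intros)
  then show ?thesis .
qed

lemma data_is_iterated_limit:
  "g \<le> Suc n \<Longrightarrow> \<exists>f. opr f \<and> (\<forall>p. limn g (f p) = Some (data n p g))"
proof (induction g)
  case 0
  have "data n p 0 z = (if pfst z = 0 then p (psnd z) else 0)" for p z
    by (simp add: data_def)
  moreover have "opr (\<lambda>p z. if pfst z = 0 then p (psnd z) else 0)" by (intro opr_intros)
  ultimately have "opr (\<lambda>p z. data n p 0 z)" by simp
  then show ?case by (intro exI[of _ "\<lambda>p. data n p 0"]) simp
next
  case (Suc g)
  then obtain f where f: "opr f" "\<And>p. limn g (f p) = Some (data n p g)" by auto
  obtain f' where f': "opr f'" "\<And>q p. limn g q = Some p \<Longrightarrow> limn g (f' q) = Some (next_data n g p)"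
    using opr_limn[OF opr_next_data] by blast
  have "limn (Suc g) (f' (f p)) = Some (data n p (Suc g))" for p
    using limn_Suc[OF f'(2)[OF f(2)] limB_next_data] Suc.prems by simp
  then show ?case using opr_subst[OF f'(1) f(1)] by blast
qed

lemma computed_from_data:
  assumes "opr F"
  obtains f where "opr f" "\<And>p. limn n (f p) = Some (F (data n p n))"
proof -
  obtain f where f: "opr f" "\<And>p. limn n (f p) = Some (data n p n)"
    using data_is_iterated_limit[of n n] by auto
  obtain f' where f': "opr f'" "\<And>q p. limn n q = Some p \<Longrightarrow> limn n (f' q) = Some (F p)"
    using opr_limn[OF assms] by blast
  show thesis by (rule that[OF opr_subst[OF f'(1) f(1)] f'(2)[OF f(2)]])
qed

subsection \<open>Upper bounds\<close>

text \<open>For labels \<open>n\<close> and \<open>n + 1\<close> the responses of layer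
  \<open>n\<close> are merely enumerated as \<open>i\<close> grows. This is what makes the
  constraint on profiles closed rather than decidable from \<open>D\<close>.\<close>

definition forced_move :: "nat \<Rightarrow> baire \<Rightarrow> nat \<Rightarrow> nat \<Rightarrow> nat" where
  "forced_move n D i N = (if D (prod_encode (2, N)) \<noteq> 0 then D (prod_encode (2, N))
     else next_response n n D i (word_of N))"

text \<open>Profiles are identified with points of Cantor space through the numbering of words;
  a word is listed if its last bit contradicts the forced move at the corresponding position.\<close>
definition profile_name :: "nat \<Rightarrow> baire \<Rightarrow> baire" where
  "profile_name n D z = (let N = length (word_of (pfst z)) - 1; m = forced_move n D (psnd z) N in
     if word_of (pfst z) \<noteq> [] \<and> m \<noteq> 0 \<and> bit_at (word_of (pfst z)) N \<noteq> (m = 2) then Suc (pfst z) else 0)"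

lemma opr_forced_move [opr_intros]:
  "opr i \<Longrightarrow> opr N \<Longrightarrow> opr (\<lambda>D x. forced_move n D (i D x) (N D x))"
  unfolding forced_move_def by (intro opr_intros)

lemma opr_profile_name: "opr (profile_name n)"
proof -
  have nonempty: "w \<noteq> [] \<longleftrightarrow> length w \<noteq> 0" for w :: "bool list" by simp
  have "opr (\<lambda>D z. profile_name n D z)"
    unfolding profile_name_def Let_def nonempty by (intro opr_intros)
  then show ?thesis .
qed

lemma mem_open_of_profile_name:
  "y \<in> open_of (profile_name n D) \<longleftrightarrow> (\<exists>i N. forced_move n D i N \<noteq> 0 \<and> y N \<noteq> (forced_move n D i N = 2))"
proof
  assume "y \<in> open_of (profile_name n D)"
  then obtain z w where z: "profile_name n D z = Suc (nat_of_word w)" and w: "in_cyl w y"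
    unfolding open_of_def by blast
  define N where "N = length w - 1"
  have "pfst z = nat_of_word w" using z unfolding profile_name_def Let_def by (auto split: if_splits)
  then have "w \<noteq> []" "forced_move n D (psnd z) N \<noteq> 0" "bit_at w N \<noteq> (forced_move n D (psnd z) N = 2)"
    using z unfolding profile_name_def Let_def N_def by (auto split: if_splits)
  moreover have "bit_at w N = y N" using w \<open>w \<noteq> []\<close> unfolding in_cyl_def bit_at_def N_def by simp
  ultimately show "\<exists>i N. forced_move n D i N \<noteq> 0 \<and> y N \<noteq> (forced_move n D i N = 2)" by blast
next
  assume "\<exists>i N. forced_move n D i N \<noteq> 0 \<and> y N \<noteq> (forced_move n D i N = 2)"
  then obtain i N where iN: "forced_move n D i N \<noteq> 0" "y N \<noteq> (forced_move n D i N = 2)" by blast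
  define w where "w = map y [0..<Suc N]"
  have w: "w \<noteq> []" "length w - 1 = N" "bit_at w N = y N"
    unfolding w_def bit_at_def by (auto simp del: upt_Suc)
  have "profile_name n D (prod_encode (nat_of_word w, i)) = Suc (nat_of_word w)"
    unfolding profile_name_def Let_def using iN w by simp
  moreover have "in_cyl w y" unfolding in_cyl_def w_def by (simp del: upt_Suc)
  ultimately show "y \<in> open_of (profile_name n D)" unfolding open_of_def by blast
qed

lemma forced_move_data:
  "forced_move n (data n p n) i N = (if game.label n p (word_of N) < n
     then advice n p (game.label n p (word_of N)) (word_of N)
     else response (owner n p n) (cover n p n) (game.region n p n) i (word_of N))"
  unfolding forced_move_def known_data[OF order_refl]
  using advice_label_neq_0[of n p "word_of N"] by (simp add: data_def)

lemma sound_if_not_forbidden: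
  assumes "y \<notin> open_of (profile_name n (data n p n))"
  shows "game.sound n p (\<lambda>w. y (nat_of_word w))"
proof (rule game.sound_if_follows_responses[OF refl])
  fix w i
  let ?g = "min n (game.label n p w)"
  assume r: "response (owner n p ?g) (cover n p ?g) (game.region n p ?g) i w \<noteq> 0"
  have "forced_move n (data n p n) i (nat_of_word w) =
      response (owner n p ?g) (cover n p ?g) (game.region n p ?g) i w"
    unfolding forced_move_data using advice_eq[OF r] by (auto simp: min_def split: if_splits)
  then show "y (nat_of_word w) = (response (owner n p ?g) (cover n p ?g) (game.region n p ?g) i w = 2)"
    using assms r unfolding mem_open_of_profile_name by metis
qed

text \<open>Forced moves at one position agree at all stages, so obeying them is possible. Together
  with \<open>sound_if_not_forbidden\<close> this yields determinacy itself, which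
  \<open>Win_le_LPO\<close> relies on.\<close>

lemma not_all_forbidden: "\<exists>y. y \<notin> open_of (profile_name n (data n p n))"
proof -
  define y where "y N = (advice n p (min n (game.label n p (word_of N))) (word_of N) = 2)" for N
  have "y N = (forced_move n (data n p n) i N = 2)" if f: "forced_move n (data n p n) i N \<noteq> 0" for i N
  proof (cases "game.label n p (word_of N) < n")
    case True
    then show ?thesis unfolding y_def forced_move_data by simp
  next
    case False
    then show ?thesis using advice_eq[of n p n i "word_of N"] f unfolding y_def forced_move_data
      by simp
  qed
  then show ?thesis unfolding mem_open_of_profile_name by blast
qed

lemma weihrauch_leI:
  assumes "opr k" "opr h"
    and "\<And>G. realizes G g \<Longrightarrow>
      realizes (\<lambda>p. Option.bind (G (h p)) (\<lambda>r. Some (k (pairB p r)))) f"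
  shows "f \<le>\<^sub>W g"
  unfolding weihrauch_le_def
  by (rule exI[of _ "\<lambda>p. Some (k p)"], rule exI[of _ "\<lambda>p. Some (h p)"])
     (use assms opr_computable in auto)

lemma pairB_odd [simp]: "pairB p r (Suc (2 * x)) = r x"
  unfolding pairB_def by simp

lemma Det_le_C_Cantor: "Det (rep_Dm (Suc n)) \<le>\<^sub>W jumpn n C_Cantor"
proof -
  obtain h where h: "opr h" "\<And>p. limn n (h p) = Some (profile_name n (data n p n))"
    using computed_from_data[OF opr_profile_name] by blast
  have k: "opr (\<lambda>p x. p (Suc (2 * x)))" by (intro opr_intros)
  show ?thesis
  proof (rule weihrauch_leI[OF k h(1)])
    fix G assume G: "realizes G (jumpn n C_Cantor)"
    show "realizes (\<lambda>p. Option.bind (G (h p)) (\<lambda>r. Some (\<lambda>x. pairB p r (Suc (2 * x))))) (Det (rep_Dm (Suc n)))"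
      unfolding realizes_def Det_def prod.case
    proof (intro allI impI, elim conjE)
      fix p A assume p: "rep_game (rep_Dm (Suc n)) p = Some A"
      let ?C = "- open_of (profile_name n (data n p n))"
      have "(jump_rep ^^ n) rep_closed (h p) = Some ?C"
        unfolding jump_rep_funpow h(2) rep_closed_def by simp
      moreover have "?C \<noteq> {}" using not_all_forbidden by blast
      ultimately obtain q y where q: "G (h p) = Some q" "rep_cantor q = Some y" "y \<in> ?C"
        using G unfolding realizes_def jumpn_def C_Cantor_def prod.case by blast
      then have "game.sound n p (\<lambda>w. y (nat_of_word w))" using sound_if_not_forbidden by blast
      from sound_imp_winning[OF p this]
      have "winning A 1 (\<lambda>w. y (nat_of_word w)) \<or> winning A 2 (\<lambda>w. y (nat_of_word w))"
        by (auto split: if_splits)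
      moreover have "rep_profile q = Some (\<lambda>w. y (nat_of_word w))"
        using q(2) unfolding rep_profile_def rep_cantor_def by (auto split: if_splits)
      ultimately show "\<exists>r s. Option.bind (G (h p)) (\<lambda>r. Some (\<lambda>x. pairB p r (Suc (2 * x)))) = Some r \<and>
          rep_profile r = Some s \<and> s \<in> {s. winning A 1 s \<or> winning A 2 s}"
        using q(1) by simp
    qed
  qed
qed

lemma Win_le_LPO: "Win (rep_Dm (Suc n)) \<le>\<^sub>W jumpn n LPO"
proof -
  \<comment> \<open>The stages of layer \<open>n\<close> at the root. \<open>LPO\<close> answers 1
    iff the root never enters \<open>region (n + 1)\<close>, that is, iff player 2 wins; adding one
    gives the winner's number.\<close>
  define F where "F D z = (of_bool (next_stage n n D z (word_of 0)) :: nat)" for D z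
  have "opr (\<lambda>D z. F D z)" unfolding F_def by (intro opr_intros)
  then obtain h where h: "opr h" "\<And>p. limn n (h p) = Some (F (data n p n))"
    using computed_from_data[of F] by blast
  have k: "opr (\<lambda>p x. Suc (p (Suc (2 * 0))))" by (intro opr_intros)
  show ?thesis
  proof (rule weihrauch_leI[OF k h(1)])
    fix G assume G: "realizes G (jumpn n LPO)"
    show "realizes (\<lambda>p. Option.bind (G (h p)) (\<lambda>r. Some (\<lambda>x. Suc (pairB p r (Suc (2 * 0)))))) (Win (rep_Dm (Suc n)))"
      unfolding realizes_def Win_def prod.case
    proof (intro allI impI, elim conjE)
      fix p A assume p: "rep_game (rep_Dm (Suc n)) p = Some A"
      let ?st = "stage (owner n p n) (cover n p n) (game.region n p n)"
      have w0: "word_of 0 = []" using word_of_nat_of_word[of "[]"] by simp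
      have "(jump_rep ^^ n) rep_cantor (h p) = Some (\<lambda>k. ?st k [])"
        unfolding jump_rep_funpow h(2) rep_cantor_def F_def known_data[OF order_refl] w0 by auto
      then obtain q where q: "G (h p) = Some q" "q 0 = (if \<forall>k. \<not> ?st k [] then 1 else 0)"
        using G unfolding realizes_def jumpn_def LPO_def prod.case rep_nat_def by force
      obtain s where "game.sound n p s" using not_all_forbidden sound_if_not_forbidden by blast
      note win = sound_imp_winning[OF p this]
      have "winning A (Suc (q 0)) s"
      proof (cases "game.region n p (Suc n) []")
        case True
        then have "even (game.label n p []) = even n" by (rule game.label_parity)
        moreover have "q 0 = 0" using True q(2) by (auto elim: game.region_SucE)
        ultimately show ?thesis using win by simp
      next
        case False
        then have "game.region n p (Suc (Suc n)) []" by (rule game.region_top)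
        then have "even (game.label n p []) = even (Suc n)" by (rule game.label_parity)
        then have "winning A 2 s" using win by simp
        moreover have "Suc (q 0) = 2" using False q(2) game.region_SucI by auto
        ultimately show ?thesis by (simp only:)
      qed
      moreover have "Suc (q 0) \<in> {1, 2}" using q(2) by simp
      ultimately show "\<exists>r i. Option.bind (G (h p)) (\<lambda>r. Some (\<lambda>x. Suc (pairB p r (Suc (2 * 0))))) = Some r \<and>
          rep_nat r = Some i \<and> i \<in> {i. i \<in> {1, 2} \<and> (\<exists>s. winning A i s)}"
        using q(1) pairB_odd[of p q 0] unfolding rep_nat_def by auto
    qed
  qed
qed

subsection \<open>The challenge game\<close>

text \<open>The round \<open>k\<close> ending a phase carries everything: \<open>pfst k\<close> is
  the message, and \<open>k\<close> itself is the new commitment. Every message recurs at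
  arbitrarily late rounds, so both can be chosen freely. Adding \<open>T\<close> makes the chosen
  approximation at least as late as the opponent demanded.\<close>

definition target :: "nat \<Rightarrow> nat \<Rightarrow> nat \<Rightarrow> nat \<Rightarrow> nat" where
  "target p e T k = (if p = 0 then pfst k else prod_encode (e, T + pfst k))"

text \<open>In round \<open>k\<close> player 2 chooses the bit \<open>2 * k\<close> of the play and player 1 the bit \<open>2 * k + 1\<close>.
  The state consists of the current phase, the index under discussion and the
  round in which the previous phase ended; even phases are ended by player 1, odd ones by player 2.\<close>
primrec run :: "nat \<Rightarrow> (nat \<Rightarrow> bool) \<Rightarrow> nat \<Rightarrow> nat \<times> nat \<times> nat" where
  "run n x 0 = (0, 0, 0)"
| "run n x (Suc k) = (case run n x k of (p, e, T) \<Rightarrow>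
     if p \<le> n \<and> (if even p then x (2 * k + 1) else x (2 * k)) then (Suc p, target p e T k, k) else (p, e, T))"

text \<open>\<open>v\<close> lists a word that player 2 has spelled out before the challenge by player 1.\<close>
definition matches :: "(nat \<Rightarrow> bool) \<Rightarrow> nat \<Rightarrow> bool" where
  "matches x v \<longleftrightarrow> (\<exists>w. v = Suc (nat_of_word w) \<and> (\<forall>i<length w. x (2 * i) = w ! i \<and> \<not> x (2 * i + 1)))"

text \<open>A play stuck in phase \<open>p \<le> n\<close> has least index \<open>n + 1 - p\<close>,
  whose parity makes the player lose who should have ended that phase. Once all phases are over, the
  least index is 0 or 1; comparing with \<open>even n\<close> makes matching a win for player 1 for
  every \<open>n\<close>.\<close>

definition listed :: "nat \<Rightarrow> baire \<Rightarrow> nat \<Rightarrow> (nat \<Rightarrow> bool) \<Rightarrow> nat \<Rightarrow> bool" where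
  "listed n q b x k \<longleftrightarrow> Suc n - b \<le> fst (run n x k) \<and>
     (b = 0 \<longrightarrow> matches x (q (fst (snd (run n x k)))) = even n)"

definition challenge_name :: "nat \<Rightarrow> baire \<Rightarrow> baire" where
  "challenge_name n q z = (if even z then if even (length (word_of (z div 2))) then 2 else 1
     else if listed n q (pfst (z div 2)) (bit_at (word_of (psnd (z div 2)))) (length (word_of (psnd (z div 2))) div 2)
       then Suc (psnd (z div 2)) else 0)"

definition challenge_set :: "nat \<Rightarrow> baire \<Rightarrow> (nat \<Rightarrow> bool) set" where
  "challenge_set n q = Dm_set (Suc n) (\<lambda>b. {x. \<exists>k. listed n q b x k})"

definition alternating :: "bool list \<Rightarrow> nat" where
  "alternating w = (if even (length w) then 2 else 1)"

lemma run_cong: "(\<And>i. i < 2 * k \<Longrightarrow> x i = y i) \<Longrightarrow> run n x k = run n y k"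
proof (induction k)
  case (Suc k)
  have "x (2 * k) = y (2 * k)" "x (2 * k + 1) = y (2 * k + 1)" using Suc.prems by auto
  moreover have "run n x k = run n y k" by (rule Suc.IH) (use Suc.prems in auto)
  ultimately show ?case by (simp only: run.simps)
qed simp

lemma run_phase_Suc: "fst (run n x k) \<le> fst (run n x (Suc k))"
  by (auto split: prod.splits)

lemma run_phase_mono: "j \<le> k \<Longrightarrow> fst (run n x j) \<le> fst (run n x k)"
  by (rule lift_Suc_mono_le) (rule run_phase_Suc)

lemma run_eq_if_phase_eq: "j \<le> k \<Longrightarrow> fst (run n x j) = fst (run n x k) \<Longrightarrow> run n x j = run n x k"
proof (induction k rule: dec_induct)
  case (step k)
  then have "fst (run n x k) = fst (run n x (Suc k))" "run n x j = run n x k"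
    using run_phase_mono[of j k n x] run_phase_Suc[of n x k] by auto
  then show ?case by (auto split: prod.splits if_splits)
qed simp

lemma run_phase_le: "fst (run n x k) \<le> Suc n"
  by (induction k) (auto split: prod.splits)

lemma run_challenged: "fst (run n x k) \<noteq> 0 \<Longrightarrow> \<exists>j<k. x (2 * j + 1)"
  by (induction k) (auto split: prod.splits if_splits simp: less_Suc_eq)

text \<open>A word reaching past the challenge in round \<open>j\<close> fails whatever follows. So
  after a challenge both outcomes of \<open>matches\<close> are decided by a finite prefix, and set
  0 is open for odd \<open>n\<close> too, where it asks for a failure.\<close>

lemma matches_cong:
  assumes "j < k" "x (2 * j + 1)" "\<And>i. i < 2 * k \<Longrightarrow> x i = y i"
  shows "matches x v = matches y v"
proof -
  have "(\<forall>i<length w. x (2 * i) = w ! i \<and> \<not> x (2 * i + 1)) \<longleftrightarrow>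
      (\<forall>i<length w. y (2 * i) = w ! i \<and> \<not> y (2 * i + 1))" for w
  proof (cases "length w \<le> j")
    case True
    then show ?thesis using assms(1,3) by auto
  next
    case False
    moreover have "y (2 * j + 1)" using assms by auto
    ultimately show ?thesis using assms(2) by (meson not_le)
  qed
  then show ?thesis unfolding matches_def by simp
qed

lemma listed_cong:
  assumes "b < Suc n" "\<And>i. i < 2 * k \<Longrightarrow> x i = y i"
  shows "listed n q b x k = listed n q b y k"
proof -
  have r: "run n x k = run n y k" using assms(2) by (rule run_cong)
  have "matches x v = matches y v" if "fst (run n x k) \<noteq> 0" for v
    using run_challenged[OF that] matches_cong[of _ k x y] assms(2) by blast
  then show ?thesis unfolding listed_def r[symmetric] using assms(1) by auto
qed

lemma bit_at_map: "i < k \<Longrightarrow> bit_at (map x [0..<k]) i = x i"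
  unfolding bit_at_def by simp

lemma open_of_challenge:
  assumes "b < Suc n"
  shows "open_of (projB b (sndB (challenge_name n q))) = {x. \<exists>k. listed n q b x k}"
proof -
  have name: "projB b (sndB (challenge_name n q)) k = Suc (nat_of_word w) \<longleftrightarrow>
      k = nat_of_word w \<and> listed n q b (bit_at w) (length w div 2)" for k w
    unfolding projB_def sndB_def challenge_name_def by auto
  show ?thesis
  proof (intro set_eqI iffI)
    fix x assume "x \<in> open_of (projB b (sndB (challenge_name n q)))"
    then obtain w where w: "listed n q b (bit_at w) (length w div 2)" "in_cyl w x"
      unfolding open_of_def name by blast
    have "bit_at w i = x i" if "i < 2 * (length w div 2)" for i
      using w(2) that unfolding in_cyl_def bit_at_def by auto
    then have "listed n q b x (length w div 2)"
      using listed_cong[OF assms, of "length w div 2" "bit_at w" x q] w(1) by blast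
    then show "x \<in> {x. \<exists>k. listed n q b x k}" by blast
  next
    fix x assume "x \<in> {x. \<exists>k. listed n q b x k}"
    then obtain k where "listed n q b x k" by blast
    then have "listed n q b (bit_at (map x [0..<2 * k])) k"
      using listed_cong[OF assms, of k "bit_at (map x [0..<2 * k])" x q] by (simp add: bit_at_map)
    then have "projB b (sndB (challenge_name n q)) (nat_of_word (map x [0..<2 * k]))
        = Suc (nat_of_word (map x [0..<2 * k]))"
      unfolding name by simp
    moreover have "in_cyl (map x [0..<2 * k]) x" unfolding in_cyl_def by simp
    ultimately show "x \<in> open_of (projB b (sndB (challenge_name n q)))"
      unfolding open_of_def by blast
  qed
qed

lemma Dm_set_cong: "(\<And>b. b < m \<Longrightarrow> U b = V b) \<Longrightarrow> Dm_set m U = Dm_set m V"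
proof -
  assume eq: "\<And>b. b < m \<Longrightarrow> U b = V b"
  have "(LEAST b. x \<in> U b) = (LEAST b. x \<in> V b)" if ex: "\<exists>b<m. x \<in> U b" for x
  proof -
    obtain b where b: "b < m" "x \<in> U b" using ex by blast
    define l where "l = (LEAST b. x \<in> U b)"
    have l: "x \<in> U l" "l \<le> b" "\<And>c. c < l \<Longrightarrow> x \<notin> U c"
      unfolding l_def by (rule LeastI[of _ b], rule b) (rule Least_le, rule b, rule not_less_Least)
    have "(LEAST b. x \<in> V b) = l"
    proof (rule Least_equality)
      show "x \<in> V l" using l eq b by auto
      show "l \<le> c" if c: "x \<in> V c" for c
      proof (rule ccontr)
        assume "\<not> l \<le> c"
        then have "c < l" "c < m" using l(2) b(1) by auto
        then show False using l(3) eq c by blast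
      qed
    qed
    then show ?thesis unfolding l_def by simp
  qed
  then show ?thesis using eq unfolding Dm_set_def by (auto split: if_splits)
qed

lemma rep_game_challenge:
  "rep_game (rep_Dm (Suc n)) (challenge_name n q) = Some (alternating, challenge_set n q)"
proof -
  have "turn (challenge_name n q) = alternating"
    unfolding turn_def challenge_name_def alternating_def by auto
  moreover have "Dm_set (Suc n) (\<lambda>b. open_of (projB b (sndB (challenge_name n q)))) = challenge_set n q"
    unfolding challenge_set_def by (rule Dm_set_cong) (rule open_of_challenge)
  ultimately show ?thesis unfolding rep_game_Dm by (simp add: challenge_name_def)
qed

lemma opr_challenge_name: "opr (challenge_name n)"
proof -
  define code where "code r = prod_encode (fst r, prod_encode (snd r))" for r :: "nat \<times> nat \<times> nat"
  define step where "step N k c = (if pfst c \<le> n \<and>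
      (if even (pfst c) then bit_at (word_of N) (2 * k + 1) else bit_at (word_of N) (2 * k))
    then prod_encode (Suc (pfst c), prod_encode (target (pfst c) (pfst (psnd c)) (psnd (psnd c)) k, k))
    else c)" for N k c
  have code: "code (run n (bit_at (word_of N)) k) = rec_nat 0 (step N) k" for N k
  proof (induction k)
    case (Suc k)
    obtain p e T where r: "run n (bit_at (word_of N)) k = (p, e, T)" by (metis prod_cases3)
    then have "rec_nat 0 (step N) k = prod_encode (p, prod_encode (e, T))"
      using Suc unfolding code_def by simp
    then have "rec_nat 0 (step N) (Suc k) = step N k (prod_encode (p, prod_encode (e, T)))" by simp
    then show ?case by (simp only:) (simp add: r code_def step_def)
  qed (simp add: code_def prod_encode_def)
  have opr_code: "opr (\<lambda>q z. code (run n (bit_at (word_of (N q z))) (k q z)))"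
    if "opr N" "opr k" for N k
    unfolding code step_def target_def by (intro opr_intros that opr_comp[OF that(1)])
  have opr_phase: "opr (\<lambda>q z. fst (run n (bit_at (word_of (N q z))) (k q z)))"
    if "opr N" "opr k" for N k
    using opr_pfst[OF opr_code[OF that]] by (simp add: code_def)
  have opr_index: "opr (\<lambda>q z. fst (snd (run n (bit_at (word_of (N q z))) (k q z))))"
    if "opr N" "opr k" for N k
    using opr_pfst[OF opr_psnd[OF opr_code[OF that]]] by (simp add: code_def)
  have matches_iff: "matches (bit_at (word_of N)) v \<longleftrightarrow> v \<noteq> 0 \<and> (\<forall>i<length (word_of (v - 1)).
      bit_at (word_of N) (2 * i) = bit_at (word_of (v - 1)) i \<and> \<not> bit_at (word_of N) (2 * i + 1))" for N v
  proof (cases v)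
    case (Suc u)
    have "(\<exists>w. u = nat_of_word w \<and> P w) \<longleftrightarrow> P (word_of u)" for P
      by (metis nat_of_word_word_of word_of_nat_of_word)
    then show ?thesis using Suc unfolding matches_def by (simp add: bit_at_def)
  qed (simp add: matches_def)
  have oprb_matches: "oprb (\<lambda>q z. matches (bit_at (word_of (N q z))) (v q z))"
    if "opr N" "opr v" for N v
    unfolding matches_iff by (intro opr_intros that opr_comp[OF that(1)] opr_comp[OF that(2)])
  have "opr (\<lambda>q z. challenge_name n q z)"
    unfolding challenge_name_def listed_def
    by (intro opr_intros opr_phase opr_index oprb_matches)
  then show ?thesis .
qed

lemma run_stable:
  obtains K p e T where "\<And>k. k \<ge> K \<Longrightarrow> run n x k = (p, e, T)" "p \<le> Suc n"
proof -
  obtain K where K: "\<And>k. fst (run n x k) \<le> fst (run n x K)"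
    using ex_has_greatest_nat[of "\<lambda>_. True" 0 "\<lambda>k. fst (run n x k)" "Suc (Suc n)"] run_phase_le
    by (auto simp: less_Suc_eq_le)
  obtain p e T where r: "run n x K = (p, e, T)" by (metis prod_cases3)
  have "run n x k = (p, e, T)" if "k \<ge> K" for k
    using run_eq_if_phase_eq[OF that] run_phase_mono[OF that] K r by (metis le_antisym)
  moreover have "p \<le> Suc n" using run_phase_le[of n x K] r by simp
  ultimately show thesis by (rule that)
qed

lemma mem_challenge_set:
  assumes stable: "\<And>k. k \<ge> K \<Longrightarrow> run n x k = (p, e, T)" and "p \<le> Suc n"
  shows "x \<in> challenge_set n q \<longleftrightarrow> (if p = Suc n then matches x (q e) else odd p)"
proof -
  let ?U = "\<lambda>b. {x. \<exists>k. listed n q b x k}"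
  have U: "x \<in> ?U b \<longleftrightarrow> Suc n - b \<le> p \<and> (b = 0 \<longrightarrow> matches x (q e) = even n)" for b
  proof
    assume "x \<in> ?U b"
    then obtain k where k: "listed n q b x k" by blast
    have le: "fst (run n x k) \<le> p"
      using run_phase_mono[of k "max k K" n x] stable[of "max k K"] by simp
    have "run n x k = (p, e, T)" if "b = 0"
    proof -
      have "fst (run n x k) = fst (run n x (max k K))"
        using k that le assms(2) stable[of "max k K"] unfolding listed_def by simp
      then show ?thesis using run_eq_if_phase_eq[of k "max k K" n x] stable[of "max k K"] by simp
    qed
    then show "Suc n - b \<le> p \<and> (b = 0 \<longrightarrow> matches x (q e) = even n)"
      using k le unfolding listed_def by auto
  next
    assume "Suc n - b \<le> p \<and> (b = 0 \<longrightarrow> matches x (q e) = even n)"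
    then have "listed n q b x K" using stable[of K] unfolding listed_def by simp
    then show "x \<in> ?U b" by blast
  qed
  \<comment> \<open>For \<open>n = 0\<close> the value 1 is not the index of a set but the default
    for plays in none.\<close>
  define g where "g = (if p \<le> n then Suc n - p else if matches x (q e) = even n then 0 else 1)"
  have "x \<in> challenge_set n q \<longleftrightarrow> g mod 2 \<noteq> Suc n mod 2"
    unfolding challenge_set_def
    by (rule mem_Dm_set) (use assms(2) U in \<open>auto simp: g_def split: if_splits\<close>)
  also have "\<dots> \<longleftrightarrow> (if p = Suc n then matches x (q e) else odd p)"
  proof (cases "p \<le> n")
    case True
    then have "even (Suc n - p) = even (Suc n + p)" by simp
    then show ?thesis using True unfolding g_def by (auto simp: mod2_eq_if)
  next
    case False
    then show ?thesis using assms(2) unfolding g_def by (auto simp: mod2_eq_if)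
  qed
  finally show ?thesis .
qed

subsection \<open>Strategies in the challenge game\<close>

locale limit_chain =
  fixes n :: nat and q :: "nat \<Rightarrow> baire"
  assumes lim: "j < n \<Longrightarrow> limB (q j) = Some (q (Suc j))"
begin

text \<open>In phase \<open>p\<close> the index \<open>e\<close> refers to \<open>q (n + 1 - p)\<close>. A player claiming \<open>g\<close> of the entry at
  \<open>e\<close> may end a phase at a time \<open>T\<close> from which on the approximations of that entry satisfy \<open>g\<close>.\<close>

definition claim :: "(nat \<Rightarrow> bool) \<Rightarrow> nat \<Rightarrow> nat \<Rightarrow> bool" where
  "claim g p e \<longleftrightarrow> g (q (Suc n - p) e)"

definition safe :: "(nat \<Rightarrow> bool) \<Rightarrow> nat \<Rightarrow> nat \<Rightarrow> nat \<Rightarrow> bool" where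
  "safe g p e T \<longleftrightarrow> claim g p e \<and> (p \<le> n \<longrightarrow> (\<forall>j\<ge>T. claim g (Suc p) (prod_encode (e, j))))"

lemma eventually_entry:
  assumes "1 \<le> p" "p \<le> n"
  shows "\<exists>J. \<forall>j\<ge>J. q (n - p) (prod_encode (e, j)) = q (Suc n - p) e"
  using lim[of "n - p"] assms unfolding limB_iff by (simp add: Suc_diff_le)

text \<open>The bound \<open>J\<close> precedes \<open>g\<close> because the entry itself settles.
  Player 1 needs this uniformity: the predicate used for a challenge depends on the round chosen for
  it.\<close>

lemma eventually_safe:
  assumes "1 \<le> p"
  shows "\<exists>J. \<forall>T\<ge>J. \<forall>g. claim g p e \<longrightarrow> safe g p e T"
proof (cases "p \<le> n")
  case True
  then obtain J where "\<forall>j\<ge>J. q (n - p) (prod_encode (e, j)) = q (Suc n - p) e"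
    using eventually_entry assms by blast
  then show ?thesis unfolding safe_def claim_def by (intro exI[of _ J]) auto
qed (simp add: safe_def)

lemma safe_challenge:
  "\<exists>k\<ge>M. pfst k = i \<and> (\<forall>g. claim g 1 i \<longrightarrow> safe g 1 i k)"
proof -
  obtain J where J: "\<forall>T\<ge>J. \<forall>g. claim g 1 i \<longrightarrow> safe g 1 i T" using eventually_safe[of 1] by blast
  have "prod_encode (i, max J M) \<ge> max J M" by (rule le_prod_encode_2)
  then show ?thesis using J by (intro exI[of _ "prod_encode (i, max J M)"]) auto
qed

lemma safe_continuation:
  assumes "1 \<le> p" "p \<le> n" "claim g p e"
  shows "\<exists>k\<ge>M. safe g (Suc p) (target p e T k) k"
proof -
  obtain J where J: "\<forall>j\<ge>J. q (n - p) (prod_encode (e, j)) = q (Suc n - p) e"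
    using eventually_entry assms by blast
  define j where "j = max J T"
  have c: "claim g (Suc p) (prod_encode (e, j))" using J assms(3) unfolding claim_def j_def by simp
  obtain J' where J': "\<forall>T\<ge>J'. safe g (Suc p) (prod_encode (e, j)) T"
    using eventually_safe[of "Suc p"] c by (metis le_add1 plus_1_eq_Suc)
  \<comment> \<open>The first component steers \<open>target\<close> to \<open>(e, j)\<close>, the
    second makes the round late enough to be a safe commitment.\<close>
  define k where "k = prod_encode (j - T, max J' M)"
  have "k \<ge> max J' M" unfolding k_def by (rule le_prod_encode_2)
  moreover have "target p e T k = prod_encode (e, j)"
    using assms(1) unfolding target_def k_def j_def by simp
  ultimately show ?thesis using J' by (intro exI[of _ k]) auto
qed

text \<open>The player ending the phases of parity \<open>ev\<close> plays for \<open>g\<close>.\<close>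
lemma play_outcome:
  assumes stable: "\<And>k. k \<ge> K \<Longrightarrow> run n x k = (p, e, T)" and le: "p \<le> Suc n" and pos: "p \<noteq> 0"
    and entry: "\<And>k e T. run n x k = (0, e, T) \<Longrightarrow> x (2 * k + 1) \<Longrightarrow>
      claim g 1 (pfst k) \<and> (ev \<longrightarrow> safe g 1 (pfst k) k)"
    and stop: "\<And>k p e T. run n x k = (p, e, T) \<Longrightarrow> 1 \<le> p \<Longrightarrow> p \<le> n \<Longrightarrow> even p = ev \<Longrightarrow>
      (if ev then x (2 * k + 1) else x (2 * k)) = safe g (Suc p) (target p e T k) k"
  shows "if p = Suc n then g (q 0 e) else even p \<noteq> ev"
proof -
  \<comment> \<open>The claim survives every phase. While the opponent is to end the phase it is
    moreover safe, so each approximation the opponent may pick from \<open>T\<close> on still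
    satisfies it.\<close>
  have inv: "run n x k = (p, e, T) \<Longrightarrow> 1 \<le> p \<Longrightarrow> claim g p e \<and> (even p \<noteq> ev \<longrightarrow> safe g p e T)" for k p e T
  proof (induction k arbitrary: p e T)
    case (Suc k)
    obtain p' e' T' where r: "run n x k = (p', e', T')" by (metis prod_cases3)
    define bit where "bit \<longleftrightarrow> (if even p' then x (2 * k + 1) else x (2 * k))"
    have r': "run n x (Suc k) = (if p' \<le> n \<and> bit then (Suc p', target p' e' T' k, k) else (p', e', T'))"
      unfolding run.simps r bit_def by simp
    show ?case
    proof (cases "p' \<le> n \<and> bit")
      case False
      then have "(p', e', T') = (p, e, T)" using Suc.prems(1)[unfolded r'] by (auto split: if_splits)
      then show ?thesis using Suc.IH[OF r] Suc.prems(2) by simp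
    next
      case True
      then have new: "p = Suc p'" "e = target p' e' T' k" "T = k" using Suc.prems(1)[unfolded r'] by auto
      show ?thesis
      proof (cases "p' = 0")
        case p0: True
        then show ?thesis using entry[of k e' T'] True r new by (auto simp: target_def bit_def)
      next
        case pos: False
        then have IH: "claim g p' e' \<and> (even p' \<noteq> ev \<longrightarrow> safe g p' e' T')" using Suc.IH[OF r] by simp
        show ?thesis
        proof (cases "even p' = ev")
          case ev: True
          then have "safe g p e T" using stop[OF r] True pos new unfolding bit_def by (auto split: if_splits)
          then show ?thesis unfolding safe_def by simp
        next
          case False
          then have "safe g p' e' T'" using IH by blast
          then have "claim g p e" using True pos new unfolding safe_def target_def by simp
          then show ?thesis using False new by auto
        qed
      qed
    qed
  qed simp
  have c: "claim g p e" using inv[OF stable[OF order_refl]] pos by simp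
  show ?thesis
  proof (cases "p = Suc n")
    case True
    then show ?thesis using c unfolding claim_def by simp
  next
    case False
    then have pn: "1 \<le> p" "p \<le> n" using le pos by auto
    have "even p \<noteq> ev"
    proof
      assume ev: "even p = ev"
      \<comment> \<open>The player never gets stuck in an own phase: a true claim has safe rounds to
        continue arbitrarily late, and \<open>stop\<close> seizes one.\<close>
      obtain k where k: "k \<ge> K" "safe g (Suc p) (target p e T k) k"
        using safe_continuation[OF pn c] by blast
      have "run n x (Suc k) = (Suc p, target p e T k, k)"
        using stop[OF stable[OF k(1)] pn ev] stable[OF k(1)] k(2) pn ev by auto
      then show False using stable[of "Suc k"] k(1) by simp
    qed
    then show ?thesis using False by simp
  qed
qed

text \<open>The appended True is the move under consideration: matching is judged as if the
  challenge came now. Otherwise the padding of \<open>bit_at\<close> would let words match that have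
  not been spelled out yet.\<close>

definition strategy1 :: "bool list \<Rightarrow> bool" where
  "strategy1 w = (let k = length w div 2; x = bit_at (w @ [True]) in case run n x k of (p, e, T) \<Rightarrow>
     safe (matches x) (Suc p) (target p e T k) k)"

definition strategy2 :: "(nat \<Rightarrow> bool) \<Rightarrow> bool list \<Rightarrow> bool" where
  "strategy2 y w = (let k = length w div 2; x = bit_at w in case run n x k of (p, e, T) \<Rightarrow>
     if p = 0 then y k else safe (\<lambda>v. \<not> matches x v) (Suc p) (target p e T k) k)"

text \<open>After a challenge \<open>play_outcome\<close> applies with the claim that the entry is
  matched. Without one, the even bits avoid the open set: a listed word would have been spelled out
  by some round, and a round at which challenging it is safe would still come.\<close>

lemma strategy1_winning_or_point:
  assumes "consistent alternating 1 strategy1 x"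
  shows "x \<in> challenge_set n (q 0) \<or> ((\<forall>k. \<not> x (2 * k + 1)) \<and> (\<lambda>k. x (2 * k)) \<notin> open_of (q n))"
proof -
  obtain K p e T where stable: "\<And>k. k \<ge> K \<Longrightarrow> run n x k = (p, e, T)" and le: "p \<le> Suc n"
    using run_stable[of n x] by metis
  define x' where "x' k = bit_at (map x [0..<2 * k + 1] @ [True])" for k
  have x'_lt: "x' k i = x i" if "i \<le> 2 * k" for k i
    using that unfolding x'_def bit_at_def by (simp add: nth_append)
  have x'_eq: "x' k (2 * k + 1)" for k
    unfolding x'_def bit_at_def by (simp add: nth_append)
  have move: "x (2 * k + 1) = safe (matches (x' k)) (Suc p) (target p e T k) k"
    if r: "run n x k = (p, e, T)" for k p e T
  proof -
    have "run n (x' k) k = (p, e, T)" using r run_cong[of k "x' k" x n] x'_lt by simp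
    moreover have "x (2 * k + 1) = strategy1 (map x [0..<2 * k + 1])"
      using assms unfolding consistent_def alternating_def by auto
    ultimately show ?thesis unfolding strategy1_def Let_def x'_def by simp
  qed
  have same: "matches (x' k) = matches x" if ch: "x (2 * k + 1) \<or> fst (run n x k) \<noteq> 0" for k
  proof (cases "x (2 * k + 1)")
    case True
    have "x i = x' k i" if "i < 2 * Suc k" for i
      using that True x'_lt[of i k] x'_eq[of k] by (cases "i = 2 * k + 1") auto
    then show ?thesis using matches_cong[of k "Suc k" x "x' k"] True by (intro ext) auto
  next
    case False
    then obtain j where "j < k" "x (2 * j + 1)" using ch run_challenged by blast
    then show ?thesis using matches_cong[of j k x "x' k"] x'_lt by (intro ext) auto
  qed
  show ?thesis
  proof (cases "p = 0")
    case False
    have "if p = Suc n then matches x (q 0 e) else even p \<noteq> True"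
    proof (rule play_outcome[OF stable le False])
      fix k e T assume r: "run n x k = (0, e, T)" and ch: "x (2 * k + 1)"
      have "safe (matches x) 1 (pfst k) k"
        using move[OF r] ch same[of k] by (simp add: target_def)
      then show "claim (matches x) 1 (pfst k) \<and> (True \<longrightarrow> safe (matches x) 1 (pfst k) k)"
        unfolding safe_def by simp
    next
      fix k p e T assume r: "run n x k = (p, e, T)" and "1 \<le> p"
      then show "(if True then x (2 * k + 1) else x (2 * k)) = safe (matches x) (Suc p) (target p e T k) k"
        using move[OF r] same[of k] by simp
    qed
    then have "x \<in> challenge_set n (q 0)"
      using mem_challenge_set[OF stable le, where q = "q 0"] by (auto split: if_splits)
    then show ?thesis ..
  next
    case True
    have silent: "\<not> x (2 * k + 1)" for k
    proof
      assume ch: "x (2 * k + 1)"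
      have "fst (run n x k) \<le> fst (run n x (max k K))" by (rule run_phase_mono) simp
      then have "fst (run n x k) = 0" using stable[of "max k K"] True by simp
      then have "fst (run n x (Suc k)) = 1" using ch by (auto split: prod.splits)
      moreover have "fst (run n x (Suc k)) \<le> fst (run n x (max (Suc k) K))" by (rule run_phase_mono) simp
      ultimately show False using stable[of "max (Suc k) K"] True by simp
    qed
    moreover have "(\<lambda>k. x (2 * k)) \<notin> open_of (q n)"
    proof
      assume "(\<lambda>k. x (2 * k)) \<in> open_of (q n)"
      then obtain i w where i: "q n i = Suc (nat_of_word w)" and w: "\<And>j. j < length w \<Longrightarrow> x (2 * j) = w ! j"
        unfolding open_of_def in_cyl_def by blast
      obtain k where k: "k \<ge> max K (length w)" "pfst k = i" "\<And>g. claim g 1 i \<Longrightarrow> safe g 1 i k"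
        using safe_challenge by metis
      have "x' k (2 * j) = w ! j \<and> \<not> x' k (2 * j + 1)" if "j < length w" for j
        using w[OF that] silent[of j] x'_lt[of "2 * j" k] x'_lt[of "2 * j + 1" k] that k(1) by simp
      then have "claim (matches (x' k)) 1 i" using i unfolding claim_def matches_def by auto
      then have "safe (matches (x' k)) 1 i k" by (rule k(3))
      moreover have "run n x k = (0, e, T)" using stable[of k] k(1) True by simp
      ultimately have "x (2 * k + 1)" using move[of k] k(2) by (simp add: target_def)
      with silent show False by blast
    qed
    ultimately show ?thesis by blast
  qed
qed

text \<open>Until the challenge player 2 spells out \<open>y\<close>, so an entry matched then would
  list a prefix of \<open>y\<close>. Hence the claim that the entry is not matched is true at the
  challenge, and \<open>play_outcome\<close> applies to the odd phases.\<close>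

lemma strategy2_winning:
  assumes y: "y \<notin> open_of (q n)"
  shows "winning (alternating, challenge_set n (q 0)) 2 (strategy2 y)"
proof -
  have "x \<notin> challenge_set n (q 0)" if x: "consistent alternating 2 (strategy2 y) x" for x
  proof -
    obtain K p e T where stable: "\<And>k. k \<ge> K \<Longrightarrow> run n x k = (p, e, T)" and le: "p \<le> Suc n"
      using run_stable[of n x] by metis
    define x' where "x' k = bit_at (map x [0..<2 * k])" for k
    have x': "x' k i = x i" if "i < 2 * k" for k i
      using that unfolding x'_def by (simp add: bit_at_map)
    have move: "x (2 * k) = (if p = 0 then y k
        else safe (\<lambda>v. \<not> matches (x' k) v) (Suc p) (target p e T k) k)"
      if r: "run n x k = (p, e, T)" for k p e T
    proof -
      have "run n (x' k) k = (p, e, T)" using r run_cong[of k "x' k" x n] x' by simp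
      moreover have "x (2 * k) = strategy2 y (map x [0..<2 * k])"
        using x unfolding consistent_def alternating_def by auto
      ultimately show ?thesis unfolding strategy2_def Let_def x'_def by simp
    qed
    have "if p = Suc n then \<not> matches x (q 0 e) else even p \<noteq> False" if pos: "p \<noteq> 0"
    proof (rule play_outcome[OF stable le pos])
      fix k e T assume r: "run n x k = (0, e, T)" and ch: "x (2 * k + 1)"
      have "\<not> matches x (q n (pfst k))"
      proof
        assume "matches x (q n (pfst k))"
        then obtain w where w: "q n (pfst k) = Suc (nat_of_word w)"
          "\<And>i. i < length w \<Longrightarrow> x (2 * i) = w ! i \<and> \<not> x (2 * i + 1)"
          unfolding matches_def by blast
        have "length w \<le> k" using w(2)[of k] ch by (meson not_le)
        have "y i = w ! i" if "i < length w" for i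
        proof -
          obtain p' e' T' where r': "run n x i = (p', e', T')" by (metis prod_cases3)
          have "p' = 0" using run_phase_mono[of i k n x] that \<open>length w \<le> k\<close> r r' by simp
          then show ?thesis using move[OF r'] w(2)[OF that] by simp
        qed
        then have "y \<in> open_of (q n)" using w(1) unfolding open_of_def in_cyl_def by auto
        with y show False ..
      qed
      then show "claim (\<lambda>v. \<not> matches x v) 1 (pfst k) \<and> (False \<longrightarrow> safe (\<lambda>v. \<not> matches x v) 1 (pfst k) k)"
        unfolding claim_def by simp
    next
      fix k p e T assume r: "run n x k = (p, e, T)" and p: "1 \<le> p"
      then obtain j where "j < k" "x (2 * j + 1)" using run_challenged[of n x k] by auto
      then have "matches (x' k) = matches x" using matches_cong[of j k x "x' k"] x' by (intro ext) auto
      then show "(if False then x (2 * k + 1) else x (2 * k)) =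
          safe (\<lambda>v. \<not> matches x v) (Suc p) (target p e T k) k"
        using move[OF r] p by simp
    qed
    then show ?thesis using mem_challenge_set[OF stable le, where q = "q 0"] by (cases "p = 0") (auto split: if_splits)
  qed
  then show ?thesis unfolding winning_def by simp
qed

end

lemma ex_play: "\<exists>x. \<forall>k. x k = s (map x [0..<k])" for s :: "bool list \<Rightarrow> bool"
proof -
  define u where "u = rec_nat [] (\<lambda>_ w. w @ [s w])"
  define x where "x k = s (u k)" for k
  have "map x [0..<k] = u k" for k by (induction k) (auto simp: u_def x_def)
  then show ?thesis by (intro exI[of _ x]) (simp add: x_def)
qed

lemma ex_joint_play:
  "\<exists>x. consistent alternating 1 s x \<and> consistent alternating 2 t x"
proof -
  obtain x where "\<And>k. x k = (\<lambda>w. if alternating w = 1 then s w else t w) (map x [0..<k])"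
    using ex_play[of "\<lambda>w. if alternating w = 1 then s w else t w"] by blast
  then show ?thesis unfolding consistent_def alternating_def by (intro exI[of _ x]) auto
qed

context limit_chain
begin

lemma player1_wins:
  assumes "open_of (q n) = UNIV"
  shows "winning (alternating, challenge_set n (q 0)) 1 strategy1"
  using strategy1_winning_or_point assms unfolding winning_def by auto

lemma not_both_win:
  assumes "winning (alternating, challenge_set n (q 0)) 1 s" "winning (alternating, challenge_set n (q 0)) 2 t"
  shows False
  using ex_joint_play[of s t] assms unfolding winning_def by auto

text \<open>\<open>strategy1\<close> is not assumed computable, but against a winning
  \<open>s\<close> it never challenges. The play between them is thus the one where player 1 always
  answers False, and this can be computed from \<open>s\<close> alone.\<close>

lemma player2_wins_point:
  assumes "winning (alternating, challenge_set n (q 0)) 2 s"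
    and w: "w 0 = []" "\<And>k. w (Suc k) = w k @ [s (w k), False]"
  shows "(\<lambda>k. s (w k)) \<notin> open_of (q n)"
proof -
  obtain x where x: "consistent alternating 1 strategy1 x" "consistent alternating 2 s x"
    using ex_joint_play by blast
  have "x \<notin> challenge_set n (q 0)" using assms(1) x(2) unfolding winning_def by simp
  then have silent: "\<And>k. \<not> x (2 * k + 1)" and pt: "(\<lambda>k. x (2 * k)) \<notin> open_of (q n)"
    using strategy1_winning_or_point[OF x(1)] by auto
  have move: "x (2 * k) = s (map x [0..<2 * k])" for k
    using x(2) unfolding consistent_def alternating_def by auto
  have "map x [0..<2 * k] = w k" for k
  proof (induction k)
    case (Suc k)
    have "map x [0..<2 * Suc k] = map x [0..<2 * k] @ [x (2 * k), x (2 * k + 1)]" by simp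
    then show ?case using Suc w(2) move[of k] silent[of k] by simp
  qed (simp add: w)
  then show ?thesis using pt move by simp
qed

end

subsection \<open>Lower bounds\<close>

lemma limit_chain_of_limn:
  assumes "limn n p = Some c"
  obtains q where "limit_chain n q" "q 0 = p" "q n = c"
  using limn_chain[OF assms] unfolding limit_chain_def by metis

lemma C_Cantor_le_Det: "jumpn n C_Cantor \<le>\<^sub>W Det (rep_Dm (Suc n))"
proof -
  \<comment> \<open>The number of the position after the given number of rounds in which player 2
    follows the profile and player 1 stays silent.\<close>
  define code where "code r = rec_nat 0 (\<lambda>_ N. nat_of_word
      (word_of (nat_of_word (word_of N @ [r N = 1])) @ [False]))" for r :: baire
  define k where "k p x = p (Suc (2 * code (\<lambda>i. p (Suc (2 * i))) x))" for p :: baire and x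
  have "opr (\<lambda>p x. k p x)" unfolding k_def code_def by (intro opr_intros)
  then have opr_k: "opr k" .
  show ?thesis
  proof (rule weihrauch_leI[OF opr_k opr_challenge_name])
    fix G assume G: "realizes G (Det (rep_Dm (Suc n)))"
    show "realizes (\<lambda>p. Option.bind (G (challenge_name n p)) (\<lambda>r. Some (k (pairB p r)))) (jumpn n C_Cantor)"
      unfolding realizes_def jumpn_def C_Cantor_def prod.case
    proof (intro allI impI, elim conjE)
      fix p A assume "(jump_rep ^^ n) rep_closed p = Some A" and ne: "A \<noteq> {}"
      then obtain c where c: "limn n p = Some c" "A = - open_of c"
        unfolding jump_rep_funpow rep_closed_def by (auto simp: bind_eq_Some_conv)
      obtain q where q: "limit_chain n q" "q 0 = p" "q n = c" using limit_chain_of_limn[OF c(1)] .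
      interpret limit_chain n q by (rule q(1))
      obtain y where "y \<notin> open_of (q n)" using ne c q by blast
      note win2 = strategy2_winning[OF this, unfolded q(2)]
      obtain r s where r: "G (challenge_name n p) = Some r" "rep_profile r = Some s"
        "winning (alternating, challenge_set n p) 1 s \<or> winning (alternating, challenge_set n p) 2 s"
        using G win2 rep_game_challenge[of n p] unfolding realizes_def Det_def prod.case by blast
      then have s2: "winning (alternating, challenge_set n (q 0)) 2 s"
        using not_both_win[unfolded q(2)] win2 q(2) by blast
      have rs: "\<And>i. r i \<le> 1" "\<And>w. s w = (r (nat_of_word w) = 1)"
        using r(2) unfolding rep_profile_def by (auto split: if_splits)
      define w where "w i = word_of (code r i)" for i
      have "w 0 = []" unfolding w_def code_def using word_of_nat_of_word[of "[]"] by simp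
      moreover have "w (Suc i) = w i @ [s (w i), False]" for i
        unfolding w_def rs(2) code_def by simp
      ultimately have "(\<lambda>i. s (w i)) \<in> A"
        using player2_wins_point[OF s2, of w] c q by simp
      moreover have "rep_cantor (k (pairB p r)) = Some (\<lambda>i. s (w i))"
        unfolding rep_cantor_def k_def using rs by (simp add: w_def)
      ultimately show "\<exists>qa y. Option.bind (G (challenge_name n p)) (\<lambda>r. Some (k (pairB p r))) = Some qa \<and>
          rep_cantor qa = Some y \<and> y \<in> A"
        using r(1) by simp
    qed
  qed
qed

lemma LPO_le_Win: "jumpn n LPO \<le>\<^sub>W Win (rep_Dm (Suc n))"
proof -
  \<comment> \<open>Player 2 wins iff the sequence is zero, the case in which \<open>LPO\<close>
    answers 1, so subtracting one translates the winner.\<close>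
  have opr_k: "opr (\<lambda>p x. p (Suc (2 * 0)) - 1)" by (intro opr_intros)
  show ?thesis
  proof (rule weihrauch_leI[OF opr_k opr_challenge_name])
    fix G assume G: "realizes G (Win (rep_Dm (Suc n)))"
    show "realizes (\<lambda>p. Option.bind (G (challenge_name n p)) (\<lambda>r. Some (\<lambda>x. pairB p r (Suc (2 * 0)) - 1)))
        (jumpn n LPO)"
      unfolding realizes_def jumpn_def LPO_def prod.case
    proof (intro allI impI, elim conjE)
      fix p x assume "(jump_rep ^^ n) rep_cantor p = Some x"
      then obtain c where c: "limn n p = Some c" "\<And>k. c k \<le> 1" "x = (\<lambda>k. c k = 1)"
        unfolding jump_rep_funpow rep_cantor_def by (auto simp: bind_eq_Some_conv split: if_splits)
      obtain q where q: "limit_chain n q" "q 0 = p" "q n = c" using limit_chain_of_limn[OF c(1)] .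
      interpret limit_chain n q by (rule q(1))
      \<comment> \<open>Read as the name of an open set, the value 1 lists the empty word.\<close>
      have empty: "open_of c = {}" if "\<forall>k. \<not> x k"
      proof -
        have "c k = 0" for k using c(2)[of k] that c(3) by (auto simp: le_Suc_eq)
        then show ?thesis unfolding open_of_def by simp
      qed
      have full: "open_of c = UNIV" if "x k" for k
      proof -
        have "c k = Suc (nat_of_word [])" using that c(3) by simp
        then show ?thesis unfolding open_of_def in_cyl_def by (force intro: exI[of _ k])
      qed
      have win2: "\<exists>s. winning (alternating, challenge_set n p) 2 s" if "\<forall>k. \<not> x k"
        using strategy2_winning empty[OF that] q by auto
      have win1: "\<exists>s. winning (alternating, challenge_set n p) 1 s" if "\<not> (\<forall>k. \<not> x k)"
        using player1_wins full that q by auto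
      have "\<exists>i. i \<in> {1, 2} \<and> (\<exists>s. winning (alternating, challenge_set n p) i s)"
        using win1 win2 by blast
      then obtain r i where r: "G (challenge_name n p) = Some r" "rep_nat r = Some i"
        "i \<in> {1, 2}" "\<exists>s. winning (alternating, challenge_set n p) i s"
        using G rep_game_challenge[of n p] unfolding realizes_def Win_def prod.case by blast
      have "i - 1 = (if \<forall>k. \<not> x k then 1 else 0)"
        using r(3,4) win1 win2 not_both_win[unfolded q(2)] by (auto split: if_splits)
      moreover have "r 0 = i" using r(2) unfolding rep_nat_def by simp
      ultimately show "\<exists>qa y. Option.bind (G (challenge_name n p)) (\<lambda>r. Some (\<lambda>x. pairB p r (Suc (2 * 0)) - 1)) = Some qa \<and>
          rep_nat qa = Some y \<and> y \<in> {if \<forall>k. \<not> x k then 1 else 0}"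
        using r(1) pairB_odd[of p r 0] unfolding rep_nat_def by simp
    qed
  qed
qed

theorem theorem15:
  fixes n :: nat
  shows "Det (rep_Dm (Suc n)) \<equiv>\<^sub>W jumpn n C_Cantor \<and> Win (rep_Dm (Suc n)) \<equiv>\<^sub>W jumpn n LPO"
  unfolding weihrauch_eq_def
  using Det_le_C_Cantor C_Cantor_le_Det Win_le_LPO LPO_le_Win by blast

end
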